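(* Suppose $A$ is a noetherian (locally finite) $\mathbb{N}$-graded algebra over a field with $A_0$ semisimple, and let $e_1,\dots,e_n$ be the primitive idempotents of $A_0$ fixed in the context. Let $0\neq X\in\mathbf{D}^-(\mathrm{gr}\,A)$ and let $P^\bullet$ be the minimal graded projective resolution of $X$, with differentials $d^{m}_{P^\bullet}\colon P^m\to P^{m+1}$. If $p=-\mathrm{inf.deg}(X)=-\mathrm{inf.deg}(e_kX)$ for some $1\leqslant k\leqslant n$, then there exists $\beta\in\mathbb{Z}$ with $H^{-\beta}(e_kP^\bullet)\neq0$ such that $$\mathrm{inf.deg}(\ker d^{-\beta}_{P^\bullet})=\beta-p\quad\text{and}\quad e_k\big(\ker d^{-\beta}_{P^\bullet}\big)_{\beta-p}\neq0.$$
   Context: An $\mathbb{N}$-graded algebra $A=\bigoplus_{i\geqslant 0}A_i$ is always an algebra over a field that is locally finite: each $A_i$ is finite-dimensional. Noetherian means left and right noetherian. Modules are graded left modules. $\mathrm{gr}\,A$ is the category of finitely generated graded $A$-modules with degree-zero morphisms; $\mathbf{D}^-(\mathrm{gr}\,A)$ is its derived category of right bounded (bounded above) cochain complexes. $J$ is the graded Jacobson radical of $A$ (here $J=A_{\geqslant1}$, as $A_0$ is semisimple), and $S=A/J=A_0$. $e_1,\dots,e_n$ are orthogonal primitive idempotents of $A_0$ such that $Se_1,\dots,Se_n$ represent all the isomorphism classes of simple left $S$-modules, without repetition. A graded projective complex $(P^\bullet,d^\bullet)$ is minimal if $\mathrm{Im}\,d^m\subseteq JP^{m+1}$ for all $m$;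 every $X\in\mathbf{D}^-(\mathrm{gr}\,A)$ has a minimal graded projective resolution, i.e. a graded projective resolution that is a minimal complex. For a complex $X$, $e_kX$ is the complex of graded vector spaces with terms $e_kX^i$. For a graded module (or graded vector space) $M$, $\mathrm{inf.deg}(M)=\inf\{i\mid M_i\neq0\}$; for a complex $X$ of graded modules or graded vector spaces, $\mathrm{inf.deg}(X)=\inf\{i+j\mid H^i(X)_j\neq 0,\ i,j\in\mathbb{Z}\}$. *)

theory Defs
  imports "HOL-Algebra.Module" "HOL-Algebra.AbelCoset" "HOL-Library.Extended_Real"
begin

section \<open>Left modules over a ring that need not be commutative\<close>

text \<open>
  The record type \<^typ>\<open>('a, 'b) module\<close> is the one of the library, whose locale
  \<^locale>\<open>module\<close> requires a commutative ring. As in the library, the fields for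
  multiplication and unit of the record play no role when it is used as a module.
\<close>

locale left_module = R?: ring R + M?: abelian_group M for R (structure) and M (structure) +
  assumes smult_closed [simp, intro]:
      "\<lbrakk>a \<in> carrier R; x \<in> carrier M\<rbrakk> \<Longrightarrow> a \<odot>\<^bsub>M\<^esub> x \<in> carrier M"
    and smult_l_distr:
      "\<lbrakk>a \<in> carrier R; b \<in> carrier R; x \<in> carrier M\<rbrakk> \<Longrightarrow>
        (a \<oplus>\<^bsub>R\<^esub> b) \<odot>\<^bsub>M\<^esub> x = a \<odot>\<^bsub>M\<^esub> x \<oplus>\<^bsub>M\<^esub> b \<odot>\<^bsub>M\<^esub> x"
    and smult_r_distr:
      "\<lbrakk>a \<in> carrier R; x \<in> carrier M; y \<in> carrier M\<rbrakk> \<Longrightarrow>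
        a \<odot>\<^bsub>M\<^esub> (x \<oplus>\<^bsub>M\<^esub> y) = a \<odot>\<^bsub>M\<^esub> x \<oplus>\<^bsub>M\<^esub> a \<odot>\<^bsub>M\<^esub> y"
    and smult_assoc:
      "\<lbrakk>a \<in> carrier R; b \<in> carrier R; x \<in> carrier M\<rbrakk> \<Longrightarrow>
        (a \<otimes>\<^bsub>R\<^esub> b) \<odot>\<^bsub>M\<^esub> x = a \<odot>\<^bsub>M\<^esub> (b \<odot>\<^bsub>M\<^esub> x)"
    and smult_one [simp]:
      "x \<in> carrier M \<Longrightarrow> \<one>\<^bsub>R\<^esub> \<odot>\<^bsub>M\<^esub> x = x"

definition left_module_hom ::
  "('a, 'r) ring_scheme \<Rightarrow> ('a, 'b, 'm) module_scheme \<Rightarrow> ('a, 'c, 'n) module_scheme \<Rightarrow> ('b \<Rightarrow> 'c) \<Rightarrow> bool"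
  where "left_module_hom R M N f \<longleftrightarrow>
    f \<in> carrier M \<rightarrow> carrier N \<and>
    (\<forall>x\<in>carrier M. \<forall>y\<in>carrier M. f (x \<oplus>\<^bsub>M\<^esub> y) = f x \<oplus>\<^bsub>N\<^esub> f y) \<and>
    (\<forall>a\<in>carrier R. \<forall>x\<in>carrier M. f (a \<odot>\<^bsub>M\<^esub> x) = a \<odot>\<^bsub>N\<^esub> f x)"

definition left_module_iso ::
  "('a, 'r) ring_scheme \<Rightarrow> ('a, 'b, 'm) module_scheme \<Rightarrow> ('a, 'c, 'n) module_scheme \<Rightarrow> bool"
  where "left_module_iso R M N \<longleftrightarrow>
    (\<exists>f. left_module_hom R M N f \<and> bij_betw f (carrier M) (carrier N))"

definition fin_gen :: "('a, 'r) ring_scheme \<Rightarrow> ('a, 'b, 'm) module_scheme \<Rightarrow> bool"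
  where "fin_gen R M \<longleftrightarrow>
    (\<exists>G. finite G \<and> G \<subseteq> carrier M \<and>
      (\<forall>N. submodule N R M \<and> G \<subseteq> N \<longrightarrow> N = carrier M))"

definition regular_module :: "('a, 'r) ring_scheme \<Rightarrow> ('a, 'a) module"
  where "regular_module R =
    \<lparr>carrier = carrier R, mult = mult R, one = one R, zero = zero R, add = add R,
     smult = mult R\<rparr>"

definition opposite_ring :: "('a, 'r) ring_scheme \<Rightarrow> ('a, 'r) ring_scheme"
  where "opposite_ring R = R\<lparr>mult := \<lambda>x y. y \<otimes>\<^bsub>R\<^esub> x\<rparr>"

text \<open>The submodules of the regular module are the left ideals.\<close>

definition left_noetherian :: "('a, 'r) ring_scheme \<Rightarrow> bool"
  where "left_noetherian R \<longleftrightarrow> ring R \<and>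
    (\<forall>I. submodule I R (regular_module R) \<longrightarrow>
      fin_gen R ((regular_module R)\<lparr>carrier := I\<rparr>))"

definition noetherian :: "('a, 'r) ring_scheme \<Rightarrow> bool"
  where "noetherian R \<longleftrightarrow> left_noetherian R \<and> left_noetherian (opposite_ring R)"

definition internal_direct_sum :: "('b, 'm) ring_scheme \<Rightarrow> 'i set \<Rightarrow> ('i \<Rightarrow> 'b set) \<Rightarrow> bool"
  where "internal_direct_sum M I V \<longleftrightarrow>
    (\<forall>i\<in>I. additive_subgroup (V i) M) \<and>
    (\<forall>x\<in>carrier M. \<exists>!f. (\<forall>i\<in>I. f i \<in> V i) \<and> (\<forall>i. i \<notin> I \<longrightarrow> f i = \<zero>\<^bsub>M\<^esub>) \<and>
      finite {i. f i \<noteq> \<zero>\<^bsub>M\<^esub>} \<and> x = finsum M f {i. f i \<noteq> \<zero>\<^bsub>M\<^esub>})"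

definition simple_module :: "('a, 'r) ring_scheme \<Rightarrow> ('a, 'b, 'm) module_scheme \<Rightarrow> bool"
  where "simple_module R M \<longleftrightarrow> left_module R M \<and> carrier M \<noteq> {\<zero>\<^bsub>M\<^esub>} \<and>
    (\<forall>N. submodule N R M \<longrightarrow> N = {\<zero>\<^bsub>M\<^esub>} \<or> N = carrier M)"

definition semisimple_module :: "('a, 'r) ring_scheme \<Rightarrow> ('a, 'b, 'm) module_scheme \<Rightarrow> bool"
  where "semisimple_module R M \<longleftrightarrow> left_module R M \<and>
    (\<exists>\<S>. (\<forall>N\<in>\<S>. submodule N R M \<and> simple_module R (M\<lparr>carrier := N\<rparr>)) \<and>
      internal_direct_sum M \<S> (\<lambda>N. N))"

definition semisimple_ring :: "('a, 'r) ring_scheme \<Rightarrow> bool"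
  where "semisimple_ring R \<longleftrightarrow> ring R \<and> semisimple_module R (regular_module R)"


section \<open>Graded algebras and graded modules\<close>

text \<open>
  With \<^typ>\<open>'i\<close> the naturals this record carries \<open>\<nat>\<close>-graded algebras over a field (the scalar
  multiplication is then that of the field), with \<^typ>\<open>'i\<close> the integers it carries graded
  modules over such an algebra and graded vector spaces.
\<close>

record ('a, 'b, 'i) graded_module = "('a, 'b) module" +
  component :: "'i \<Rightarrow> 'b set"

locale graded_algebra = left_module K A + K?: field K + A?: ring A
  for K :: "'k ring" (structure) and A :: "('k, 'a, nat) graded_module" (structure) +
  assumes smult_mult_left:
      "\<lbrakk>c \<in> carrier K; x \<in> carrier A; y \<in> carrier A\<rbrakk> \<Longrightarrow>
        (c \<odot>\<^bsub>A\<^esub> x) \<otimes>\<^bsub>A\<^esub> y = c \<odot>\<^bsub>A\<^esub> (x \<otimes>\<^bsub>A\<^esub> y)"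
    and smult_mult_right:
      "\<lbrakk>c \<in> carrier K; x \<in> carrier A; y \<in> carrier A\<rbrakk> \<Longrightarrow>
        x \<otimes>\<^bsub>A\<^esub> (c \<odot>\<^bsub>A\<^esub> y) = c \<odot>\<^bsub>A\<^esub> (x \<otimes>\<^bsub>A\<^esub> y)"
    and component_subspace: "submodule (component A i) K A"
    and direct_sum: "internal_direct_sum A UNIV (component A)"
    and one_component: "\<one>\<^bsub>A\<^esub> \<in> component A 0"
    and mult_component:
      "\<lbrakk>x \<in> component A i; y \<in> component A j\<rbrakk> \<Longrightarrow> x \<otimes>\<^bsub>A\<^esub> y \<in> component A (i + j)"

definition locally_finite :: "'k ring \<Rightarrow> ('k, 'a, nat) graded_module \<Rightarrow> bool"
  where "locally_finite K A \<longleftrightarrow> (\<forall>i. fin_gen K (A\<lparr>carrier := component A i\<rparr>))"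

definition degree_zero_ring :: "('k, 'a, nat) graded_module \<Rightarrow> ('k, 'a, nat) graded_module"
  where "degree_zero_ring A = A\<lparr>carrier := component A 0\<rparr>"

definition graded_left_ideal :: "('k, 'a, nat) graded_module \<Rightarrow> 'a set \<Rightarrow> bool"
  where "graded_left_ideal A I \<longleftrightarrow> submodule I A (regular_module A) \<and>
    internal_direct_sum (A\<lparr>carrier := I\<rparr>) UNIV (\<lambda>i. component A i \<inter> I)"

definition maximal_graded_left_ideal :: "('k, 'a, nat) graded_module \<Rightarrow> 'a set \<Rightarrow> bool"
  where "maximal_graded_left_ideal A I \<longleftrightarrow> graded_left_ideal A I \<and> I \<noteq> carrier A \<and>
    (\<forall>L. graded_left_ideal A L \<and> I \<subseteq> L \<longrightarrow> L = I \<or> L = carrier A)"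

definition graded_radical :: "('k, 'a, nat) graded_module \<Rightarrow> 'a set"
  where "graded_radical A = carrier A \<inter> \<Inter>{I. maximal_graded_left_ideal A I}"

locale graded_left_module = left_module A M
  for A :: "('k, 'a, nat) graded_module" (structure)
    and M :: "('a, 'm, int) graded_module" (structure) +
  assumes direct_sum: "internal_direct_sum M UNIV (component M)"
    and smult_component:
      "\<lbrakk>a \<in> component A i; x \<in> component M j\<rbrakk> \<Longrightarrow> a \<odot>\<^bsub>M\<^esub> x \<in> component M (int i + j)"

definition gr_object :: "('k, 'a, nat) graded_module \<Rightarrow> ('a, 'm, int) graded_module \<Rightarrow> bool"
  where "gr_object A M \<longleftrightarrow> graded_left_module A M \<and> fin_gen A M"

definition gr_hom ::
  "('k, 'a, nat) graded_module \<Rightarrow> ('a, 'm, int) graded_module \<Rightarrow> ('a, 'n, int) graded_module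
    \<Rightarrow> ('m \<Rightarrow> 'n) \<Rightarrow> bool"
  where "gr_hom A M N f \<longleftrightarrow> left_module_hom A M N f \<and>
    (\<forall>j. f ` component M j \<subseteq> component N j)"

text \<open>
  The lifting property in the category of finitely generated graded modules. A formula cannot
  quantify over types, so the carriers of the test modules are sets of sequences in \<open>A\<close>. This
  is no restriction: a finitely generated graded module is a quotient of a finite direct sum of
  shifts of \<open>A\<close>, hence isomorphic to one whose carrier is a set of representatives of the cosets.
\<close>

definition graded_projective ::
  "('k, 'a, nat) graded_module \<Rightarrow> ('a, 'm, int) graded_module \<Rightarrow> bool"
  where "graded_projective A P \<longleftrightarrow> gr_object A P \<and>
    (\<forall>(M :: ('a, nat \<Rightarrow> 'a, int) graded_module) (N :: ('a, nat \<Rightarrow> 'a, int) graded_module) g f.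
      gr_object A M \<and> gr_object A N \<and> gr_hom A M N g \<and> g ` carrier M = carrier N \<and> gr_hom A P N f
      \<longrightarrow> (\<exists>h. gr_hom A P M h \<and> (\<forall>x\<in>carrier P. g (h x) = f x)))"

definition sub_graded :: "('a, 'm, int) graded_module \<Rightarrow> 'm set \<Rightarrow> ('a, 'm, int) graded_module"
  where "sub_graded M N = M\<lparr>carrier := N, component := \<lambda>j. component M j \<inter> N\<rparr>"

text \<open>
  The elements of the quotient are the cosets \<open>N + x\<close>; the product of \<open>a\<close> with the coset \<open>C\<close> is
  \<open>N + aC\<close>.
\<close>

definition quotient_graded ::
  "('a, 'm, int) graded_module \<Rightarrow> 'm set \<Rightarrow> ('a, 'm set, int) graded_module"
  where "quotient_graded M N =
    \<lparr>carrier = a_rcosets\<^bsub>M\<^esub> N, mult = undefined, one = undefined, zero = N, add = set_add M,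
     smult = (\<lambda>a C. N <+>\<^bsub>M\<^esub> (smult M a ` C)),
     component = (\<lambda>j. (\<lambda>x. N +>\<^bsub>M\<^esub> x) ` component M j)\<rparr>"

text \<open>The graded vector space \<open>eM\<close>, on which a scalar \<open>c\<close> acts as \<open>c1 \<in> A\<close>.\<close>

definition idempotent_part ::
  "('k, 'a, nat) graded_module \<Rightarrow> 'a \<Rightarrow> ('a, 'm, int) graded_module \<Rightarrow> ('k, 'm, int) graded_module"
  where "idempotent_part A e M =
    \<lparr>carrier = smult M e ` carrier M, mult = mult M, one = one M, zero = zero M, add = add M,
     smult = (\<lambda>c x. (c \<odot>\<^bsub>A\<^esub> \<one>\<^bsub>A\<^esub>) \<odot>\<^bsub>M\<^esub> x),
     component = (\<lambda>j. smult M e ` component M j)\<rparr>"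

definition set_smult :: "('k, 'a, nat) graded_module \<Rightarrow> 'a set \<Rightarrow> ('a, 'm, int) graded_module \<Rightarrow> 'm set"
  where "set_smult A I M =
    \<Inter>{N. submodule N A M \<and> (\<forall>a\<in>I. \<forall>x\<in>carrier M. a \<odot>\<^bsub>M\<^esub> x \<in> N)}"

text \<open>The infimum in the extended reals; it is \<open>\<infinity>\<close> for the zero module.\<close>

definition inf_deg :: "('a, 'm, int) graded_module \<Rightarrow> ereal"
  where "inf_deg M = Inf {ereal (of_int j) | j. component M j \<noteq> {\<zero>\<^bsub>M\<^esub>}}"


section \<open>Complexes\<close>

record ('a, 'm) gr_complex =
  obj :: "int \<Rightarrow> ('a, 'm, int) graded_module"
  diff :: "int \<Rightarrow> 'm \<Rightarrow> 'm"

definition kernel_diff :: "('a, 'm) gr_complex \<Rightarrow> int \<Rightarrow> ('a, 'm, int) graded_module"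
  where "kernel_diff X i =
    sub_graded (obj X i) {x \<in> carrier (obj X i). diff X i x = \<zero>\<^bsub>obj X (i + 1)\<^esub>}"

definition image_diff :: "('a, 'm) gr_complex \<Rightarrow> int \<Rightarrow> 'm set"
  where "image_diff X i = diff X i ` carrier (obj X i)"

definition cohomology :: "('a, 'm) gr_complex \<Rightarrow> int \<Rightarrow> ('a, 'm set, int) graded_module"
  where "cohomology X i = quotient_graded (kernel_diff X i) (image_diff X (i - 1))"

definition zero_module :: "('a, 'm, int) graded_module \<Rightarrow> bool"
  where "zero_module M \<longleftrightarrow> carrier M = {\<zero>\<^bsub>M\<^esub>}"

definition complex_inf_deg :: "('a, 'm) gr_complex \<Rightarrow> ereal"
  where "complex_inf_deg X =
    Inf {ereal (of_int (i + j)) | i j. component (cohomology X i) j \<noteq> {\<zero>\<^bsub>cohomology X i\<^esub>}}"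

definition idempotent_complex ::
  "('k, 'a, nat) graded_module \<Rightarrow> 'a \<Rightarrow> ('a, 'm) gr_complex \<Rightarrow> ('k, 'm) gr_complex"
  where "idempotent_complex A e X = \<lparr>obj = (\<lambda>i. idempotent_part A e (obj X i)), diff = diff X\<rparr>"

text \<open>The objects of the derived category of right bounded complexes over \<open>gr A\<close>.\<close>

definition right_bounded_complex :: "('k, 'a, nat) graded_module \<Rightarrow> ('a, 'm) gr_complex \<Rightarrow> bool"
  where "right_bounded_complex A X \<longleftrightarrow>
    (\<forall>i. gr_object A (obj X i)) \<and>
    (\<forall>i. gr_hom A (obj X i) (obj X (i + 1)) (diff X i)) \<and>
    (\<forall>i. \<forall>x\<in>carrier (obj X i). diff X (i + 1) (diff X i x) = \<zero>\<^bsub>obj X (i + 1 + 1)\<^esub>) \<and>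
    (\<exists>b. \<forall>i>b. zero_module (obj X i))"

text \<open>An object of the derived category is zero if and only if all its cohomology vanishes.\<close>

definition derived_zero :: "('a, 'm) gr_complex \<Rightarrow> bool"
  where "derived_zero X \<longleftrightarrow> (\<forall>i. zero_module (cohomology X i))"

definition chain_map ::
  "('k, 'a, nat) graded_module \<Rightarrow> ('a, 'm) gr_complex \<Rightarrow> ('a, 'n) gr_complex
    \<Rightarrow> (int \<Rightarrow> 'm \<Rightarrow> 'n) \<Rightarrow> bool"
  where "chain_map A X Y \<phi> \<longleftrightarrow>
    (\<forall>i. gr_hom A (obj X i) (obj Y i) (\<phi> i)) \<and>
    (\<forall>i. \<forall>x\<in>carrier (obj X i). \<phi> (i + 1) (diff X i x) = diff Y i (\<phi> i x))"

text \<open>The map induced in cohomology sends a coset \<open>C\<close> to the coset \<open>B + \<phi>(C)\<close>, \<open>B\<close> the coboundaries.\<close>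

definition quasi_iso ::
  "('k, 'a, nat) graded_module \<Rightarrow> ('a, 'm) gr_complex \<Rightarrow> ('a, 'n) gr_complex
    \<Rightarrow> (int \<Rightarrow> 'm \<Rightarrow> 'n) \<Rightarrow> bool"
  where "quasi_iso A X Y \<phi> \<longleftrightarrow> chain_map A X Y \<phi> \<and>
    (\<forall>i. bij_betw (\<lambda>C. image_diff Y (i - 1) <+>\<^bsub>obj Y i\<^esub> (\<phi> i ` C))
      (carrier (cohomology X i)) (carrier (cohomology Y i)))"

definition graded_projective_resolution ::
  "('k, 'a, nat) graded_module \<Rightarrow> ('a, 'm) gr_complex \<Rightarrow> ('a, 'p) gr_complex \<Rightarrow> bool"
  where "graded_projective_resolution A X P \<longleftrightarrow> right_bounded_complex A P \<and>
    (\<forall>i. graded_projective A (obj P i)) \<and> (\<exists>\<phi>. quasi_iso A P X \<phi>)"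

definition minimal_complex :: "('k, 'a, nat) graded_module \<Rightarrow> ('a, 'p) gr_complex \<Rightarrow> bool"
  where "minimal_complex A P \<longleftrightarrow>
    (\<forall>m. image_diff P m \<subseteq> set_smult A (graded_radical A) (obj P (m + 1)))"


section \<open>Primitive idempotents\<close>

definition primitive_idempotent :: "('a, 'r) ring_scheme \<Rightarrow> 'a \<Rightarrow> bool"
  where "primitive_idempotent R e \<longleftrightarrow> e \<in> carrier R \<and> e \<otimes>\<^bsub>R\<^esub> e = e \<and> e \<noteq> \<zero>\<^bsub>R\<^esub> \<and>
    (\<forall>f\<in>carrier R. \<forall>g\<in>carrier R. f \<otimes>\<^bsub>R\<^esub> f = f \<and> g \<otimes>\<^bsub>R\<^esub> g = g \<and>
      f \<otimes>\<^bsub>R\<^esub> g = \<zero>\<^bsub>R\<^esub> \<and> g \<otimes>\<^bsub>R\<^esub> f = \<zero>\<^bsub>R\<^esub> \<and> e = f \<oplus>\<^bsub>R\<^esub> g \<longrightarrow> f = \<zero>\<^bsub>R\<^esub> \<or> g = \<zero>\<^bsub>R\<^esub>)"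

definition principal_left_ideal :: "('a, 'r) ring_scheme \<Rightarrow> 'a \<Rightarrow> ('a, 'a) module"
  where "principal_left_ideal R e =
    (regular_module R)\<lparr>carrier := (\<lambda>x. x \<otimes>\<^bsub>R\<^esub> e) ` carrier R\<rparr>"

text \<open>
  Every simple left \<open>S\<close>-module is a quotient of \<open>S\<close>, hence isomorphic to one whose carrier
  consists of elements of \<^typ>\<open>'a\<close>; quantifying over these covers all isomorphism classes.
\<close>

definition simple_representatives :: "('a, 'r) ring_scheme \<Rightarrow> nat \<Rightarrow> (nat \<Rightarrow> 'a) \<Rightarrow> bool"
  where "simple_representatives S n e \<longleftrightarrow>
    (\<forall>i\<in>{1..n}. primitive_idempotent S (e i)) \<and>
    (\<forall>i\<in>{1..n}. \<forall>j\<in>{1..n}. i \<noteq> j \<longrightarrow> e i \<otimes>\<^bsub>S\<^esub> e j = \<zero>\<^bsub>S\<^esub>) \<and>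
    (\<forall>i\<in>{1..n}. simple_module S (principal_left_ideal S (e i))) \<and>
    (\<forall>M :: ('a, 'a) module. simple_module S M \<longrightarrow>
      (\<exists>i\<in>{1..n}. left_module_iso S (principal_left_ideal S (e i)) M)) \<and>
    (\<forall>i\<in>{1..n}. \<forall>j\<in>{1..n}. i \<noteq> j \<longrightarrow>
      \<not> left_module_iso S (principal_left_ideal S (e i)) (principal_left_ideal S (e j)))"

end

theory Submission
  imports Defs
begin

text \<open>
  Put \<open>q = -p\<close>. Since \<open>A\<^sub>0\<close> is semisimple, \<open>J\<close> lies in \<open>A\<^bsub>\<ge>1\<^esub>\<close>, so minimality of \<open>P\<close> makes the lowest
  degree component of \<open>P\<^sup>i\<close> free of coboundaries. By descending induction on \<open>i\<close>, the bound
  \<open>H\<^sup>i(P)\<^sub>j = 0\<close> for \<open>i + j < q\<close> lifts to \<open>P\<^sup>i\<^sub>j = 0\<close> for \<open>i + j < q\<close>.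
  A nonzero class in \<open>H\<^sup>i(e\<^sub>kX)\<^sub>j\<close> with \<open>i + j = q\<close> is then transported along the quasi-isomorphism
  to a cocycle in \<open>e\<^sub>kP\<^sup>i\<^sub>j\<close>, and \<open>\<beta> = -i\<close>.
\<close>

section \<open>Components with respect to a direct sum decomposition\<close>

text \<open>A bound on the cohomology of \<open>X\<close> says nothing about coboundaries of
  \<open>P\<close> in low degrees, yet these lie in the kernels whose lowest degree is wanted; so
  the bound has to be proved for the terms of \<open>P\<close> and not just for its cohomology. The
  two infima act separately: the one for \<open>X\<close> gives this bound, the one for the
  \<open>e k\<close> part gives the class that attains it. Likewise injectivity of the map in
  cohomology serves the bound, and surjectivity serves the class. Since the quasi-isomorphism runs
  from \<open>P\<close> to \<open>X\<close>, the class lifts only up to a coboundary, and the lift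
  is in general neither homogeneous nor fixed by \<open>e k\<close>. Projection to degree
  \<open>j\<close> and multiplication by \<open>e k\<close> repair this, because both commute with
  differentials and chain maps; for the projection this is an instance of
  \<open>part_commute\<close>.\<close>

lemma additive_homI:
  assumes "abelian_group G" "abelian_group H"
    and "\<And>x. x \<in> carrier G \<Longrightarrow> h x \<in> carrier H"
    and "\<And>x y. \<lbrakk>x \<in> carrier G; y \<in> carrier G\<rbrakk> \<Longrightarrow> h (x \<oplus>\<^bsub>G\<^esub> y) = h x \<oplus>\<^bsub>H\<^esub> h y"
  shows "abelian_group_hom G H h"
proof -
  interpret G: abelian_group G by fact
  interpret H: abelian_group H by fact
  show ?thesis
    by (intro abelian_group_homI group_hom.intro group_hom_axioms.intro G.abelian_group_axioms
        H.abelian_group_axioms G.a_group H.a_group homI) (use assms in auto)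
qed

lemma (in abelian_group) subgroup_is_abelian_group:
  assumes H: "additive_subgroup H G"
  shows "abelian_group (G\<lparr>carrier := H\<rparr>)"
proof (rule abelian_groupI)
  interpret H: additive_subgroup H G by (rule H)
  note H_closed = H.a_subset[THEN subsetD]
  show "\<exists>y\<in>carrier (G\<lparr>carrier := H\<rparr>). y \<oplus>\<^bsub>G\<lparr>carrier := H\<rparr>\<^esub> x = \<zero>\<^bsub>G\<lparr>carrier := H\<rparr>\<^esub>"
    if "x \<in> carrier (G\<lparr>carrier := H\<rparr>)" for x
    using that H_closed H.a_inv_closed by (auto intro!: bexI[of _ "\<ominus> x"] simp: l_neg)
qed (use additive_subgroup.a_subset[OF H] additive_subgroup.a_closed[OF H]
    additive_subgroup.zero_closed[OF H] in \<open>auto simp: subset_iff a_ac\<close>)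

text \<open>The index set is arbitrary so that one locale covers two cases: gradings, indexed by all
  degrees, and the decomposition of the degree zero ring into simple left ideals, where the set of
  summands is indexed by itself.\<close>

locale direct_sum_group = abelian_group M for M (structure) +
  fixes I :: "'i set" and V :: "'i \<Rightarrow> 'b set"
  assumes decomposition: "internal_direct_sum M I V"
begin

definition is_decomp :: "'b \<Rightarrow> ('i \<Rightarrow> 'b) \<Rightarrow> bool" where
  "is_decomp x f \<longleftrightarrow> (\<forall>i\<in>I. f i \<in> V i) \<and> (\<forall>i. i \<notin> I \<longrightarrow> f i = \<zero>) \<and>
    finite {i. f i \<noteq> \<zero>} \<and> x = finsum M f {i. f i \<noteq> \<zero>}"

definition part :: "'b \<Rightarrow> 'i \<Rightarrow> 'b" where
  "part x = (THE f. is_decomp x f)"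

lemma summand: "i \<in> I \<Longrightarrow> additive_subgroup (V i) M"
  using decomposition by (simp add: internal_direct_sum_def)

lemma summand_closed: "\<lbrakk>i \<in> I; x \<in> V i\<rbrakk> \<Longrightarrow> x \<in> carrier M"
  using additive_subgroup.a_subset[OF summand] by blast

lemma summand_zero: "i \<in> I \<Longrightarrow> \<zero> \<in> V i"
  using additive_subgroup.zero_closed[OF summand] .

lemma ex1_decomp: "x \<in> carrier M \<Longrightarrow> \<exists>!f. is_decomp x f"
  using decomposition unfolding internal_direct_sum_def is_decomp_def by blast

lemma is_decomp_part: "x \<in> carrier M \<Longrightarrow> is_decomp x (part x)"
  unfolding part_def by (rule theI'[OF ex1_decomp])

lemma part_eqI: "\<lbrakk>x \<in> carrier M; is_decomp x f\<rbrakk> \<Longrightarrow> part x = f"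
  unfolding part_def by (rule the1_equality[OF ex1_decomp])

lemma part_mem: "\<lbrakk>x \<in> carrier M; i \<in> I\<rbrakk> \<Longrightarrow> part x i \<in> V i"
  using is_decomp_part by (auto simp: is_decomp_def)

lemma part_outside: "\<lbrakk>x \<in> carrier M; i \<notin> I\<rbrakk> \<Longrightarrow> part x i = \<zero>"
  using is_decomp_part by (auto simp: is_decomp_def)

lemma part_closed [simp, intro]: "x \<in> carrier M \<Longrightarrow> part x i \<in> carrier M"
  using part_mem part_outside summand_closed by (cases "i \<in> I") auto

lemma finite_support: "x \<in> carrier M \<Longrightarrow> finite {i. part x i \<noteq> \<zero>}"
  using is_decomp_part by (auto simp: is_decomp_def)

lemma sum_parts: "x \<in> carrier M \<Longrightarrow> x = finsum M (part x) {i. part x i \<noteq> \<zero>}"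
  using is_decomp_part by (auto simp: is_decomp_def)

lemma sum_parts_superset:
  assumes "x \<in> carrier M" "finite F" "{i. part x i \<noteq> \<zero>} \<subseteq> F"
  shows "x = finsum M (part x) F"
proof -
  have "finsum M (part x) {i. part x i \<noteq> \<zero>} = finsum M (part x) F"
    by (rule add.finprod_mono_neutral_cong_left) (use assms in auto)
  then show ?thesis using sum_parts[OF assms(1)] by simp
qed

text \<open>Any finite set containing the support is allowed, because the exact support is awkward
  to name: terms of a sum may cancel, and a single homogeneous element may be zero.\<close>

lemma is_decompI:
  assumes "\<And>i. i \<in> I \<Longrightarrow> f i \<in> V i" "\<And>i. i \<notin> I \<Longrightarrow> f i = \<zero>"
    and "finite F" "{i. f i \<noteq> \<zero>} \<subseteq> F" "x = finsum M f F"
  shows "is_decomp x f"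
proof -
  have c: "f i \<in> carrier M" for i
    using assms(1,2) summand_closed by (cases "i \<in> I") auto
  have "finsum M f {i. f i \<noteq> \<zero>} = finsum M f F"
    by (rule add.finprod_mono_neutral_cong_left) (use assms c in auto)
  then show ?thesis
    using assms finite_subset[OF assms(4,3)] by (auto simp: is_decomp_def)
qed

lemma part_add:
  assumes x: "x \<in> carrier M" and y: "y \<in> carrier M"
  shows "part (x \<oplus> y) i = part x i \<oplus> part y i"
proof -
  let ?F = "{i. part x i \<noteq> \<zero>} \<union> {i. part y i \<noteq> \<zero>}"
  have fin: "finite ?F" using finite_support x y by simp
  have "is_decomp (x \<oplus> y) (\<lambda>i. part x i \<oplus> part y i)"
  proof (rule is_decompI[where F = ?F])
    show "x \<oplus> y = (\<Oplus>i\<in>?F. part x i \<oplus> part y i)"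
      using sum_parts_superset[OF x fin] sum_parts_superset[OF y fin] x y
      by (simp add: finsum_addf)
  next
    fix i assume "i \<in> I"
    then show "part x i \<oplus> part y i \<in> V i"
      using part_mem x y additive_subgroup.a_closed[OF summand] by blast
  qed (use x y fin part_outside in auto)
  then show ?thesis using part_eqI x y by simp
qed

lemma part_hom: "abelian_group_hom M M (\<lambda>x. part x i)"
  by (intro additive_homI) (auto simp: part_add abelian_group_axioms)

lemma part_zero [simp]: "part \<zero> i = \<zero>"
  using abelian_group_hom.hom_zero[OF part_hom] .

lemma part_summand:
  assumes "j \<in> I" "x \<in> V j"
  shows "part x i = (if i = j then x else \<zero>)"
proof -
  have x: "x \<in> carrier M" using assms summand_closed by blast
  have "is_decomp x (\<lambda>i. if i = j then x else \<zero>)"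
    by (rule is_decompI[where F = "{j}"]) (use assms x summand_zero in auto)
  then show ?thesis using part_eqI[OF x] by simp
qed

lemma finsum_mem_subgroup:
  assumes H: "additive_subgroup H M" and "\<And>i. i \<in> F \<Longrightarrow> f i \<in> H"
  shows "finsum M f F \<in> H"
proof (cases "finite F")
  case True
  then show ?thesis using assms(2)
  proof (induction F)
    case empty
    then show ?case using additive_subgroup.zero_closed[OF H] by simp
  next
    case (insert i F)
    then have "f \<in> F \<rightarrow> carrier M" "f i \<in> carrier M"
      using additive_subgroup.a_subset[OF H] by auto
    then show ?case
      using insert additive_subgroup.a_closed[OF H] by (simp add: finsum_insert)
  qed
next
  case False
  then show ?thesis using additive_subgroup.zero_closed[OF H] by (simp add: finsum_infinite)
qed

lemma mem_subgroupI:
  assumes "additive_subgroup H M" "x \<in> carrier M" "\<And>i. i \<in> I \<Longrightarrow> part x i \<in> H"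
  shows "x \<in> H"
proof -
  have "finsum M (part x) {i. part x i \<noteq> \<zero>} \<in> H"
    by (rule finsum_mem_subgroup[OF assms(1)]) (use assms(2,3) part_outside in blast)
  then show ?thesis using sum_parts[OF assms(2)] by simp
qed

lemma eq_zeroI:
  assumes "x \<in> carrier M" "\<And>i. i \<in> I \<Longrightarrow> part x i = \<zero>"
  shows "x = \<zero>"
proof -
  have "additive_subgroup {\<zero>} M"
    by (intro additive_subgroupI add.triv_subgroup)
  from mem_subgroupI[OF this assms(1)] assms(2) show ?thesis by simp
qed

lemma subgroup_CollectI:
  assumes "Q \<zero>"
    and "\<And>x y. \<lbrakk>x \<in> carrier M; y \<in> carrier M; Q x; Q y\<rbrakk> \<Longrightarrow> Q (x \<oplus> y)"
    and "\<And>x. \<lbrakk>x \<in> carrier M; Q x\<rbrakk> \<Longrightarrow> Q (\<ominus> x)"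
  shows "additive_subgroup {x \<in> carrier M. Q x} M"
  by (intro additive_subgroupI add.subgroupI) (use assms in \<open>auto simp: a_inv_def[symmetric]\<close>)

text \<open>The first three closure conditions make the elements satisfying \<open>Q\<close> a
  subgroup, and an element whose parts all lie in a subgroup lies in it too. Additive claims are
  thereby reduced to homogeneous elements.\<close>

lemma subgroup_induct [consumes 1, case_names zero add inv summand]:
  assumes x: "x \<in> carrier M"
    and "Q \<zero>"
    and "\<And>x y. \<lbrakk>x \<in> carrier M; y \<in> carrier M; Q x; Q y\<rbrakk> \<Longrightarrow> Q (x \<oplus> y)"
    and "\<And>x. \<lbrakk>x \<in> carrier M; Q x\<rbrakk> \<Longrightarrow> Q (\<ominus> x)"
    and "\<And>i x. \<lbrakk>i \<in> I; x \<in> V i\<rbrakk> \<Longrightarrow> Q x"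
  shows "Q x"
proof -
  have "additive_subgroup {x \<in> carrier M. Q x} M"
    using assms by (intro subgroup_CollectI) auto
  from mem_subgroupI[OF this x] show ?thesis
    using assms(5) part_mem x by auto
qed

text \<open>Naturality of the projections. The map \<open>s\<close> on indices records a shift:
  translation by the degree for multiplication by a homogeneous element, the identity for
  degree-preserving maps. Injectivity keeps contributions of different summands from meeting in one
  summand of the target.\<close>

lemma part_commute:
  assumes N: "direct_sum_group N J W" and h: "abelian_group_hom M N h"
    and s: "inj_on s I" "s ` I \<subseteq> J" and hV: "\<And>i. i \<in> I \<Longrightarrow> h ` V i \<subseteq> W (s i)"
    and x: "x \<in> carrier M" and i: "i \<in> I"
  shows "direct_sum_group.part N J W (h x) (s i) = h (part x i)"
proof -
  interpret N: direct_sum_group N J W by (rule N)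
  interpret h: abelian_group_hom M N h by (rule h)
  show ?thesis
    using x
  proof (induction x rule: subgroup_induct)
    case (add x y)
    then show ?case by (simp add: part_add N.part_add)
  next
    case (inv x)
    then show ?case
      by (simp add: abelian_group_hom.hom_a_inv[OF part_hom] abelian_group_hom.hom_a_inv[OF N.part_hom])
  next
    case (summand j y)
    then have "h y \<in> W (s j)" "s j \<in> J" using hV s by auto
    then show ?case
      using summand s i by (auto simp: part_summand N.part_summand inj_on_eq_iff)
  qed auto
qed

text \<open>Finite sums are defined by a fold over the carrier, so the equality is not immediate
  when the carrier shrinks; it follows by induction on the index set. On an infinite index set both
  sides take the default value zero.\<close>

lemma finsum_restrict:
  assumes H: "additive_subgroup H M" and f: "f \<in> F \<rightarrow> H"
  shows "finsum (M\<lparr>carrier := H\<rparr>) f F = finsum M f F"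
proof (cases "finite F")
  case True
  have "abelian_group (M\<lparr>carrier := H\<rparr>)"
    using subgroup_is_abelian_group[OF H] .
  then interpret H: abelian_group "M\<lparr>carrier := H\<rparr>" .
  show ?thesis
    using True f
  proof (induction F)
    case (insert i F)
    then have "f \<in> F \<rightarrow> carrier M" "f i \<in> carrier M"
      using additive_subgroup.a_subset[OF H] by auto
    then show ?case using insert by (simp add: finsum_insert H.finsum_insert)
  qed simp
next
  case False
  then show ?thesis by (simp add: finsum_def finprod_def)
qed

text \<open>The parts taken in \<open>M\<close> already decompose an element inside
  \<open>H\<close>, and a decomposition inside \<open>H\<close> is also one in \<open>M\<close>, so
  uniqueness is inherited. This is what makes a left ideal closed under parts a graded one.\<close>

lemma internal_direct_sum_subgroup:
  assumes H: "additive_subgroup H M" and parts: "\<And>x i. \<lbrakk>x \<in> H; i \<in> I\<rbrakk> \<Longrightarrow> part x i \<in> H"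
  shows "internal_direct_sum (M\<lparr>carrier := H\<rparr>) I (\<lambda>i. V i \<inter> H)"
  unfolding internal_direct_sum_def
proof (intro conjI ballI)
  fix i assume i: "i \<in> I"
  have "subgroup (V i \<inter> H) (add_monoid M)"
    using summand[OF i] H by (simp add: additive_subgroup_def add.subgroups_Inter_pair)
  then have "subgroup (V i \<inter> H) ((add_monoid M)\<lparr>carrier := H\<rparr>)"
    using H by (intro add.subgroup_incl) (auto simp: additive_subgroup_def)
  then show "additive_subgroup (V i \<inter> H) (M\<lparr>carrier := H\<rparr>)"
    by (simp add: additive_subgroup_def)
next
  fix x assume "x \<in> carrier (M\<lparr>carrier := H\<rparr>)"
  then have xH: "x \<in> H" and x: "x \<in> carrier M"
    using additive_subgroup.a_subset[OF H] by auto
  have fH: "f i \<in> H" if "\<forall>i\<in>I. f i \<in> V i \<inter> H" "\<forall>i. i \<notin> I \<longrightarrow> f i = \<zero>" for f i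
    using that additive_subgroup.zero_closed[OF H] by (cases "i \<in> I") auto
  show "\<exists>!f. (\<forall>i\<in>I. f i \<in> V i \<inter> H) \<and> (\<forall>i. i \<notin> I \<longrightarrow> f i = \<zero>\<^bsub>M\<lparr>carrier := H\<rparr>\<^esub>) \<and>
      finite {i. f i \<noteq> \<zero>\<^bsub>M\<lparr>carrier := H\<rparr>\<^esub>} \<and>
      x = finsum (M\<lparr>carrier := H\<rparr>) f {i. f i \<noteq> \<zero>\<^bsub>M\<lparr>carrier := H\<rparr>\<^esub>}"
  proof (rule ex1I[of _ "part x"], goal_cases)
    case 1
    have "part x i \<in> H" for i
      using parts[OF xH] part_outside[OF x] additive_subgroup.zero_closed[OF H] by (cases "i \<in> I") auto
    then show ?case
      using is_decomp_part[OF x] by (simp add: is_decomp_def finsum_restrict[OF H])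
  next
    case (2 f)
    then have "is_decomp x f"
      using fH[of f] by (simp add: is_decomp_def finsum_restrict[OF H])
    then show ?case using part_eqI[OF x] by simp
  qed
qed

end

section \<open>Truncations of graded modules\<close>

sublocale graded_left_module \<subseteq> direct_sum_group M UNIV "component M"
  by unfold_locales (rule direct_sum)

sublocale graded_algebra \<subseteq> grading: direct_sum_group A UNIV "component A"
  by unfold_locales (rule direct_sum)

lemma (in left_module) smult_hom:
  "a \<in> carrier R \<Longrightarrow> abelian_group_hom M M (\<lambda>x. a \<odot>\<^bsub>M\<^esub> x)"
  by (intro additive_homI) (auto simp: smult_r_distr M.abelian_group_axioms)

lemma (in left_module) smult_scalar_hom:
  "x \<in> carrier M \<Longrightarrow> abelian_group_hom R M (\<lambda>a. a \<odot>\<^bsub>M\<^esub> x)"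
  by (intro additive_homI) (auto simp: smult_l_distr M.abelian_group_axioms R.abelian_group_axioms)

lemmas (in left_module) smult_zero_left [simp] = abelian_group_hom.hom_zero[OF smult_scalar_hom]

lemmas (in left_module) smult_inv_left = abelian_group_hom.hom_a_inv[OF smult_scalar_hom]

lemmas (in left_module) smult_zero_right [simp] = abelian_group_hom.hom_zero[OF smult_hom]

definition (in graded_left_module) truncation :: "int \<Rightarrow> 'm set" where
  "truncation m = {x \<in> carrier M. \<forall>j<m. part x j = \<zero>\<^bsub>M\<^esub>}"

text \<open>This is \<open>A_{>=1}\<close>: degrees are natural numbers, so an element without a
  part in degree 0 has parts in positive degrees only.\<close>

definition (in graded_algebra) positive_part :: "'a set" where
  "positive_part = {x \<in> carrier A. grading.part x 0 = \<zero>\<^bsub>A\<^esub>}"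

context graded_left_module
begin

lemma component_closed: "x \<in> component M j \<Longrightarrow> x \<in> carrier M"
  using summand_closed by blast

lemma truncation_subgroup: "additive_subgroup (truncation m) M"
  by (intro additive_subgroupI add.subgroupI)
    (auto simp: truncation_def part_add a_inv_def[symmetric] abelian_group_hom.hom_a_inv[OF part_hom])

text \<open>Multiplication by \<open>a\<close> shifts parts by \<open>i\<close>. The slack variable
  \<open>k\<close> serves two uses: \<open>k = m\<close> shows that truncations are stable, and
  \<open>k = m + 1\<close> with \<open>i\<close> positive shows that the lowest degree
  rises.\<close>

lemma smult_homogeneous_truncation:
  assumes a: "a \<in> component A i" "a \<in> carrier A" and x: "x \<in> truncation m" and k: "m + int i \<ge> k"
  shows "a \<odot>\<^bsub>M\<^esub> x \<in> truncation k"
proof -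
  have xM: "x \<in> carrier M" using x by (simp add: truncation_def)
  have "(\<lambda>y. a \<odot>\<^bsub>M\<^esub> y) ` component M j \<subseteq> component M (int i + j)" for j
    using smult_component a by blast
  then have *: "part (a \<odot>\<^bsub>M\<^esub> x) (int i + j) = a \<odot>\<^bsub>M\<^esub> part x j" for j
    by (intro part_commute[of M UNIV "component M" _ "\<lambda>j. int i + j"])
      (use a xM smult_hom direct_sum_group_axioms in \<open>auto simp: inj_on_def\<close>)
  have "part (a \<odot>\<^bsub>M\<^esub> x) j = \<zero>\<^bsub>M\<^esub>" if "j < k" for j
  proof -
    have "j - int i < m" using that k by simp
    then have "part x (j - int i) = \<zero>\<^bsub>M\<^esub>" using x by (simp add: truncation_def)
    then show ?thesis using *[of "j - int i"] a by simp
  qed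
  then show ?thesis using a xM by (simp add: truncation_def)
qed

end

locale graded_algebra_module = graded_algebra K A + graded_left_module A M
  for K :: "'k ring" (structure) and A :: "('k, 'a, nat) graded_module" (structure)
    and M :: "('a, 'm, int) graded_module" (structure)
begin

text \<open>The algebra has no negative degrees, so no homogeneous scalar lowers degrees; additivity
  extends this to all scalars.\<close>

lemma smult_truncation:
  assumes a: "a \<in> carrier A" and x: "x \<in> truncation m"
  shows "a \<odot>\<^bsub>M\<^esub> x \<in> truncation m"
  using a
proof (induction a rule: grading.subgroup_induct)
  case zero
  then show ?case using x additive_subgroup.zero_closed[OF truncation_subgroup]
    by (simp add: truncation_def)
next
  case (add a b)
  then show ?case using x additive_subgroup.a_closed[OF truncation_subgroup]
    by (simp add: truncation_def smult_l_distr)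
next
  case (inv a)
  then show ?case using x additive_subgroup.a_inv_closed[OF truncation_subgroup]
    by (simp add: truncation_def smult_inv_left)
next
  case (summand i a)
  then show ?case using smult_homogeneous_truncation x grading.summand_closed by simp
qed

lemma truncation_submodule: "submodule (truncation m) A M"
  using truncation_subgroup smult_truncation
  by (simp add: submodule_def submodule_axioms_def additive_subgroup_def)

text \<open>The claim fails in general for scalars of degree 0, which rules out an induction over
  all of \<open>A\<close>. Instead, the scalars that work for this \<open>x\<close> form a subgroup
  containing every part of \<open>a\<close>: the part of degree 0 vanishes, and the others raise
  degrees by at least 1.\<close>

lemma positive_part_smult:
  assumes a: "a \<in> positive_part" and x: "x \<in> truncation m"
  shows "a \<odot>\<^bsub>M\<^esub> x \<in> truncation (m + 1)"
proof -
  have aA: "a \<in> carrier A" using a by (simp add: positive_part_def)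
  have xM: "x \<in> carrier M" using x by (simp add: truncation_def)
  let ?H = "{b \<in> carrier A. b \<odot>\<^bsub>M\<^esub> x \<in> truncation (m + 1)}"
  have "additive_subgroup ?H A"
    using xM additive_subgroup.zero_closed[OF truncation_subgroup]
      additive_subgroup.a_closed[OF truncation_subgroup]
      additive_subgroup.a_inv_closed[OF truncation_subgroup]
    by (intro grading.subgroup_CollectI) (auto simp: smult_l_distr smult_inv_left)
  moreover have "grading.part a i \<in> ?H" for i
  proof (cases "i = 0")
    case True
    then show ?thesis
      using a xM additive_subgroup.zero_closed[OF truncation_subgroup] by (simp add: positive_part_def)
  next
    case False
    then have "grading.part a i \<odot>\<^bsub>M\<^esub> x \<in> truncation (m + 1)"
      using aA x by (intro smult_homogeneous_truncation[of _ i _ m]) (auto simp: grading.part_mem)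
    then show ?thesis using aA by simp
  qed
  ultimately show ?thesis using grading.mem_subgroupI[of ?H a] aA by blast
qed

text \<open>As \<open>set_smult\<close> is the smallest submodule containing the products, it
  suffices that the truncation is a submodule containing them.\<close>

lemma set_smult_truncation:
  assumes "I \<subseteq> positive_part" "carrier M = truncation m"
  shows "set_smult A I M \<subseteq> truncation (m + 1)"
  unfolding set_smult_def using truncation_submodule positive_part_smult assms by blast

lemma truncation_empty:
  assumes "x \<in> component M j" "x \<in> truncation m" "j < m"
  shows "x = \<zero>\<^bsub>M\<^esub>"
  using assms part_summand[of j x j] by (simp add: truncation_def)

lemma carrier_truncationI:
  assumes "\<And>j. j < m \<Longrightarrow> component M j = {\<zero>\<^bsub>M\<^esub>}"
  shows "carrier M = truncation m"
  using assms part_mem by (auto simp: truncation_def)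

text \<open>Finitely many generators have only finitely many nonzero parts, so they all lie in one
  truncation; being a submodule, it is everything.\<close>

lemma fin_gen_bounded_below:
  assumes "fin_gen A M"
  shows "\<exists>m. \<forall>j<m. component M j = {\<zero>\<^bsub>M\<^esub>}"
proof -
  obtain G where G: "finite G" "G \<subseteq> carrier M"
    and gen: "\<And>N. submodule N A M \<Longrightarrow> G \<subseteq> N \<Longrightarrow> N = carrier M"
    using assms by (auto simp: fin_gen_def)
  have "finite (\<Union>x\<in>G. {i. part x i \<noteq> \<zero>\<^bsub>M\<^esub>})"
    using G finite_support by blast
  then obtain m where m: "\<forall>i\<in>(\<Union>x\<in>G. {i. part x i \<noteq> \<zero>\<^bsub>M\<^esub>}). m \<le> i"
    using bdd_below_finite bdd_below.unfold by blast
  have "G \<subseteq> truncation m" using G m by (fastforce simp: truncation_def)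
  with gen[OF truncation_submodule] have "carrier M = truncation m" by metis
  then have "component M j = {\<zero>\<^bsub>M\<^esub>}" if "j < m" for j
    using truncation_empty[OF _ _ that] component_closed summand_zero[of j] by blast
  then show ?thesis by blast
qed

end

section \<open>The graded radical\<close>

lemma regular_module_sel [simp]:
  "carrier (regular_module R) = carrier R" "add (regular_module R) = add R"
  "zero (regular_module R) = zero R" "smult (regular_module R) = mult R"
  by (simp_all add: regular_module_def)

lemma degree_zero_ring_sel [simp]:
  "carrier (degree_zero_ring A) = component A 0" "add (degree_zero_ring A) = add A"
  "zero (degree_zero_ring A) = zero A" "mult (degree_zero_ring A) = mult A"
  by (simp_all add: degree_zero_ring_def)

lemma subgroup_regular_module [simp]:
  "subgroup H (add_monoid (regular_module R)) \<longleftrightarrow> subgroup H (add_monoid R)"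
  by (simp add: subgroup_def m_inv_def)

text \<open>For natural numbers \<open>i + j = 0\<close> forces \<open>i = j = 0\<close>, so only
  the two degree zero parts contribute to the degree zero part of a product. Both sides are
  biadditive, whence the nested induction.\<close>

lemma (in graded_algebra) part_zero_mult:
  assumes a: "a \<in> carrier A" and b: "b \<in> carrier A"
  shows "grading.part (a \<otimes>\<^bsub>A\<^esub> b) 0 = grading.part a 0 \<otimes>\<^bsub>A\<^esub> grading.part b 0"
  using a
proof (induction a rule: grading.subgroup_induct)
  case zero
  then show ?case using b by simp
next
  case (add x y)
  then show ?case using b by (simp add: grading.part_add A.l_distr)
next
  case (inv x)
  then show ?case using b
    by (simp add: abelian_group_hom.hom_a_inv[OF grading.part_hom] A.l_minus)
next
  case (summand i x)
  then have x: "x \<in> carrier A" using grading.summand_closed by simp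
  show ?case
    using b
  proof (induction b rule: grading.subgroup_induct)
    case zero
    then show ?case using x by simp
  next
    case (add y z)
    then show ?case using x by (simp add: grading.part_add A.r_distr)
  next
    case (inv y)
    then show ?case using x
      by (simp add: abelian_group_hom.hom_a_inv[OF grading.part_hom] A.r_minus)
  next
    case (summand j y)
    then have y: "y \<in> carrier A" using grading.summand_closed by simp
    have "x \<otimes>\<^bsub>A\<^esub> y \<in> component A (i + j)"
      using mult_component summand \<open>x \<in> component A i\<close> by simp
    then show ?case
      using summand \<open>x \<in> component A i\<close> x y by (auto simp: grading.part_summand)
  qed
qed

text \<open>
  If the degree zero part \<open>x\<^sub>0\<close> of \<open>x\<close> is not zero, then it has a nonzero component in some simple
  summand \<open>N\<close> of \<open>A\<^sub>0\<close>, and the kernel of \<open>A \<rightarrow> A\<^sub>0 \<rightarrow> N\<close> is a maximal graded left ideal that does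
  not contain \<open>x\<close>.
\<close>

lemma (in graded_algebra) graded_radical_positive:
  assumes "semisimple_ring (degree_zero_ring A)"
  shows "graded_radical A \<subseteq> positive_part"
proof
  fix x assume x: "x \<in> graded_radical A"
  then have xA: "x \<in> carrier A" by (simp add: graded_radical_def)
  let ?S = "degree_zero_ring A"
  let ?R = "regular_module ?S"
  obtain \<S> where lm: "left_module ?S ?R"
    and simple: "\<And>N. N \<in> \<S> \<Longrightarrow> submodule N ?S ?R \<and> simple_module ?S (?R\<lparr>carrier := N\<rparr>)"
    and ds: "internal_direct_sum ?R \<S> (\<lambda>N. N)"
    using assms unfolding semisimple_ring_def semisimple_module_def by blast
  interpret R: left_module ?S ?R by (rule lm)
  interpret D: direct_sum_group ?R \<S> "\<lambda>N. N"
    by unfold_locales (rule ds)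
  have part0: "grading.part y 0 \<in> carrier ?R" if "y \<in> carrier A" for y
    using grading.part_mem[OF that] by simp
  show "x \<in> positive_part"
  proof (rule ccontr)
    assume "x \<notin> positive_part"
    then have "grading.part x 0 \<noteq> \<zero>\<^bsub>?R\<^esub>" using xA by (simp add: positive_part_def)
    then obtain N where N: "N \<in> \<S>" and xN: "D.part (grading.part x 0) N \<noteq> \<zero>\<^bsub>A\<^esub>"
      using D.eq_zeroI[OF part0[OF xA]] by auto
    define q where "q y = D.part (grading.part y 0) N" for y
    have q_mem: "q y \<in> N" if "y \<in> carrier A" for y
      using D.part_mem[OF part0[OF that] N] by (simp add: q_def)
    have q_zero: "q \<zero>\<^bsub>A\<^esub> = \<zero>\<^bsub>A\<^esub>"
      using D.part_zero by (simp add: q_def)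
    have q_add: "q (y \<oplus>\<^bsub>A\<^esub> z) = q y \<oplus>\<^bsub>A\<^esub> q z" if "y \<in> carrier A" "z \<in> carrier A" for y z
      using D.part_add[of "grading.part y 0" "grading.part z 0"] part0 that
      by (simp add: q_def grading.part_add)
    have q_closed: "q y \<in> carrier A" if "y \<in> carrier A" for y
      using D.part_closed[OF part0[OF that]] grading.summand_closed[of 0] by (simp add: q_def)
    have q_hom: "abelian_group_hom A ?R q"
      using q_add q_mem D.summand_closed[OF N]
      by (intro additive_homI) (simp_all add: M.abelian_group_axioms R.M.abelian_group_axioms)
    have "abelian_group_hom A A q"
      using q_add q_closed by (intro additive_homI) (simp_all add: M.abelian_group_axioms)
    note q_inv = abelian_group_hom.hom_a_inv[OF this]
    \<comment> \<open>Left multiplication by the degree zero part of \<open>a\<close> preserves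
      every summand in \<open>\<S>\<close>, so it commutes with the projection to
      \<open>N\<close>.\<close>
    have q_mult: "q (a \<otimes>\<^bsub>A\<^esub> y) = grading.part a 0 \<otimes>\<^bsub>A\<^esub> q y"
      if a: "a \<in> carrier A" and y: "y \<in> carrier A" for a y
    proof -
      have "D.part (grading.part a 0 \<odot>\<^bsub>?R\<^esub> grading.part y 0) (id N)
          = grading.part a 0 \<odot>\<^bsub>?R\<^esub> D.part (grading.part y 0) N"
      proof (rule D.part_commute)
        show "abelian_group_hom ?R ?R ((\<odot>\<^bsub>?R\<^esub>) (grading.part a 0))"
          using R.smult_hom part0[OF a] by simp
        show "(\<odot>\<^bsub>?R\<^esub>) (grading.part a 0) ` i \<subseteq> id i" if "i \<in> \<S>" for i
          using submodule.smult_closed[of i ?S ?R] simple[OF that] part0[OF a] by auto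
      qed (use D.direct_sum_group_axioms part0[OF y] N in auto)
      then show ?thesis using part_zero_mult[OF a y] by (simp add: q_def)
    qed
    define I where "I = {y \<in> carrier A. q y = \<zero>\<^bsub>A\<^esub>}"
    have I_sub: "additive_subgroup I A"
      unfolding I_def by (rule grading.subgroup_CollectI) (simp_all add: q_zero q_add q_inv)
    have "a \<otimes>\<^bsub>A\<^esub> y \<in> I" if "a \<in> carrier A" "y \<in> I" for a y
      using that grading.part_closed[of a 0] by (auto simp: I_def q_mult)
    then have "submodule I A (regular_module A)"
      using I_sub unfolding submodule_def submodule_axioms_def additive_subgroup_def
      by (simp only: subgroup_regular_module) simp
    \<comment> \<open>The map \<open>q\<close> sees only degree 0: it kills every part of positive
      degree and takes the same value on \<open>y\<close> and on its part of degree 0.\<close>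
    moreover have "grading.part y i \<in> I" if "y \<in> I" for y i
    proof -
      have y: "y \<in> carrier A" "q y = \<zero>\<^bsub>A\<^esub>" using that by (auto simp: I_def)
      have "grading.part (grading.part y i) 0 = (if i = 0 then grading.part y 0 else \<zero>\<^bsub>A\<^esub>)"
        using grading.part_summand[OF _ grading.part_mem[OF y(1)], of i 0] by auto
      then show ?thesis using y D.part_zero by (auto simp: I_def q_def)
    qed
    ultimately have gI: "graded_left_ideal A I"
      unfolding graded_left_ideal_def using grading.internal_direct_sum_subgroup[OF I_sub] by blast
    have xI: "x \<notin> I" using xN by (simp add: I_def q_def)
    \<comment> \<open>The image of \<open>L\<close> in \<open>N\<close> is a nonzero submodule over
      the degree zero ring, hence all of \<open>N\<close> by simplicity. So every \<open>a\<close>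
      differs from some element of \<open>L\<close> by an element of the kernel \<open>I\<close>,
      which \<open>L\<close> contains.\<close>
    have max: "L = carrier A" if L: "graded_left_ideal A L" "I \<subseteq> L" "L \<noteq> I" for L
    proof -
      have Lm: "submodule L A (regular_module A)" using L by (simp add: graded_left_ideal_def)
      then have L_sub: "additive_subgroup L A"
        by (simp only: submodule_def additive_subgroup_def subgroup_regular_module)
      note L_closed = additive_subgroup.a_subset[OF L_sub, THEN subsetD]
      obtain z where z: "z \<in> L" "q z \<noteq> \<zero>\<^bsub>A\<^esub>"
        using L L_closed by (auto simp: I_def)
      have N_sub: "subgroup N (add_monoid ?R)" using simple[OF N] by (simp add: submodule_def)
      have "subgroup (q ` L) (add_monoid ?R)"
        using group_hom.subgroup_img_is_subgroup[OF abelian_group_hom.a_group_hom[OF q_hom]] L_sub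
        by (simp only: additive_subgroup_def)
      then have "subgroup (q ` L) ((add_monoid ?R)\<lparr>carrier := N\<rparr>)"
        using N_sub q_mem L_closed by (intro group.subgroup_incl[OF R.M.a_group]) auto
      moreover have "a \<otimes>\<^bsub>A\<^esub> u \<in> q ` L" if a: "a \<in> component A 0" and u: "u \<in> q ` L" for a u
      proof -
        obtain y where y: "y \<in> L" "u = q y" using u by auto
        have aA: "a \<in> carrier A" using a grading.summand_closed[of 0] by simp
        have "q (a \<otimes>\<^bsub>A\<^esub> y) = a \<otimes>\<^bsub>A\<^esub> u"
          using q_mult[OF aA] y L_closed grading.part_summand[of 0 a 0] a by simp
        moreover have "a \<otimes>\<^bsub>A\<^esub> y \<in> L"
          using submodule.smult_closed[OF Lm aA y(1)] by simp
        ultimately show ?thesis by (metis imageI)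
      qed
      ultimately have "submodule (q ` L) ?S (?R\<lparr>carrier := N\<rparr>)"
        by (simp add: submodule_def submodule_axioms_def)
      then have "q ` L = N"
        using simple[OF N] z unfolding simple_module_def by fastforce
      show "L = carrier A"
      proof
        show "carrier A \<subseteq> L"
        proof
          fix a assume a: "a \<in> carrier A"
          then obtain y where y: "y \<in> L" "q a = q y"
            using q_mem \<open>q ` L = N\<close> by blast
          have yA: "y \<in> carrier A" using y L_closed by blast
          have "a \<oplus>\<^bsub>A\<^esub> \<ominus>\<^bsub>A\<^esub> y \<in> I"
            using a yA y q_closed by (simp add: I_def q_add q_inv M.r_neg)
          then have "(a \<oplus>\<^bsub>A\<^esub> \<ominus>\<^bsub>A\<^esub> y) \<oplus>\<^bsub>A\<^esub> y \<in> L"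
            using L y additive_subgroup.a_closed[OF L_sub] by blast
          moreover have "(a \<oplus>\<^bsub>A\<^esub> \<ominus>\<^bsub>A\<^esub> y) \<oplus>\<^bsub>A\<^esub> y = a"
            using a yA by (simp add: M.a_assoc M.l_neg)
          ultimately show "a \<in> L" by simp
        qed
      qed (use L_closed in blast)
    qed
    have "maximal_graded_left_ideal A I"
      unfolding maximal_graded_left_ideal_def using gI max xI xA by blast
    then show False using x xI by (auto simp: graded_radical_def)
  qed
qed

section \<open>Cohomology of complexes\<close>

lemma (in abelian_group) coset_eq_self_iff:
  assumes "additive_subgroup B G" "x \<in> carrier G"
  shows "B +> x = B \<longleftrightarrow> x \<in> B"
  using assms a_coset_join1 a_coset_join2 by (auto simp: additive_subgroup_def)

text \<open>A coset depends only on the addition. With the next rule, cosets in kernels and in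
  idempotent parts become cosets in the ambient object, where one criterion for trivial classes
  applies.\<close>

lemma a_r_coset_sub_graded [simp]: "B +>\<^bsub>sub_graded M N\<^esub> x = B +>\<^bsub>M\<^esub> x"
  by (simp add: a_r_coset_def' sub_graded_def)

lemma a_r_coset_idempotent_part [simp]: "B +>\<^bsub>idempotent_part A e M\<^esub> x = B +>\<^bsub>M\<^esub> x"
  by (simp add: a_r_coset_def' idempotent_part_def)

lemma kernel_diff_sel:
  "carrier (kernel_diff X i) = {x \<in> carrier (obj X i). diff X i x = \<zero>\<^bsub>obj X (i + 1)\<^esub>}"
  "component (kernel_diff X i) j = component (obj X i) j \<inter> carrier (kernel_diff X i)"
  "zero (kernel_diff X i) = zero (obj X i)"
  "smult (kernel_diff X i) = smult (obj X i)"
  by (simp_all add: kernel_diff_def sub_graded_def)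

lemma cohomology_sel:
  "carrier (cohomology X i) = (\<lambda>x. image_diff X (i - 1) +>\<^bsub>obj X i\<^esub> x) ` carrier (kernel_diff X i)"
  "component (cohomology X i) j =
    (\<lambda>x. image_diff X (i - 1) +>\<^bsub>obj X i\<^esub> x) ` component (kernel_diff X i) j"
  "zero (cohomology X i) = image_diff X (i - 1)"
  by (auto simp: cohomology_def quotient_graded_def A_RCOSETS_def' kernel_diff_def)

lemma idempotent_part_sel:
  "carrier (idempotent_part A e M) = smult M e ` carrier M"
  "component (idempotent_part A e M) j = smult M e ` component M j"
  "zero (idempotent_part A e M) = zero M"
  by (simp_all add: idempotent_part_def)

lemma idempotent_complex_sel:
  "obj (idempotent_complex A e X) i = idempotent_part A e (obj X i)"
  "diff (idempotent_complex A e X) = diff X"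
  by (simp_all add: idempotent_complex_def)

lemma left_module_hom_additive:
  assumes "left_module R M" "left_module R N" "left_module_hom R M N f"
  shows "abelian_group_hom M N f"
  using assms by (intro additive_homI) (auto simp: left_module_def left_module_hom_def)

lemma gr_hom_part:
  assumes M: "graded_left_module A M" and N: "graded_left_module A N"
    and f: "gr_hom A M N f" and x: "x \<in> carrier M"
  shows "direct_sum_group.part N UNIV (component N) (f x) j =
    f (direct_sum_group.part M UNIV (component M) x j)"
proof -
  interpret M: graded_left_module A M by (rule M)
  interpret N: graded_left_module A N by (rule N)
  have "abelian_group_hom M N f"
    using f left_module_hom_additive[OF M.left_module_axioms N.left_module_axioms]
    by (simp add: gr_hom_def)
  then show ?thesis
    using M.part_commute[OF N.direct_sum_group_axioms, of f id] f x by (simp add: gr_hom_def)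
qed

locale module_complex = graded_algebra K A
  for K :: "'k ring" and A :: "('k, 'a, nat) graded_module" +
  fixes X :: "('a, 'm) gr_complex"
  assumes complex: "right_bounded_complex A X"
begin

lemma obj_fin_gen: "fin_gen A (obj X i)"
  using complex by (simp add: right_bounded_complex_def gr_object_def)

lemma obj_graded: "graded_left_module A (obj X i)"
  using complex by (simp add: right_bounded_complex_def gr_object_def)

lemma obj_module: "graded_algebra_module K A (obj X i)"
  using obj_graded graded_algebra_axioms by (simp add: graded_algebra_module_def)

lemma diff_gr_hom: "gr_hom A (obj X i) (obj X (i + 1)) (diff X i)"
  using complex by (simp add: right_bounded_complex_def)

lemma obj_left_module: "left_module A (obj X i)"
  using obj_graded by (simp add: graded_left_module_def)

lemma obj_group: "abelian_group (obj X i)"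
  using obj_left_module by (simp add: left_module_def)

lemma diff_hom: "abelian_group_hom (obj X i) (obj X (i + 1)) (diff X i)"
  using diff_gr_hom left_module_hom_additive[OF obj_left_module obj_left_module]
  by (simp add: gr_hom_def)

lemma diff_hom': "abelian_group_hom (obj X (i - 1)) (obj X i) (diff X (i - 1))"
  using diff_hom[of "i - 1"] by simp

lemma diff_component: "x \<in> component (obj X i) j \<Longrightarrow> diff X i x \<in> component (obj X (i + 1)) j"
  using diff_gr_hom by (auto simp: gr_hom_def)

lemma diff_smult:
  "\<lbrakk>a \<in> carrier A; x \<in> carrier (obj X i)\<rbrakk> \<Longrightarrow>
    diff X i (a \<odot>\<^bsub>obj X i\<^esub> x) = a \<odot>\<^bsub>obj X (i + 1)\<^esub> diff X i x"
  using diff_gr_hom by (auto simp: gr_hom_def left_module_hom_def)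

lemma bounded: "\<exists>b. \<forall>i>b. carrier (obj X i) = {\<zero>\<^bsub>obj X i\<^esub>}"
  using complex by (simp add: right_bounded_complex_def zero_module_def)

lemma image_diff_subgroup: "additive_subgroup (image_diff X (i - 1)) (obj X i)"
  unfolding image_diff_def
  using group_hom.img_is_subgroup[OF abelian_group_hom.a_group_hom[OF diff_hom']]
  by (simp add: additive_subgroup_def)

text \<open>Replaces cosets by representatives. The component contains the zero class, so it can
  differ from the zero singleton only through a nonzero class, never by being empty.\<close>

lemma cohomology_nonzero_iff:
  "component (cohomology X i) j \<noteq> {\<zero>\<^bsub>cohomology X i\<^esub>} \<longleftrightarrow>
    (\<exists>x\<in>component (obj X i) j. diff X i x = \<zero>\<^bsub>obj X (i + 1)\<^esub> \<and> x \<notin> image_diff X (i - 1))"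
proof -
  interpret M: graded_algebra_module K A "obj X i" by (rule obj_module)
  have "\<zero>\<^bsub>obj X i\<^esub> \<in> component (kernel_diff X i) j"
    using M.summand_zero abelian_group_hom.hom_zero[OF diff_hom]
    by (simp add: kernel_diff_sel M.component_closed)
  then have "component (cohomology X i) j \<noteq> {\<zero>\<^bsub>cohomology X i\<^esub>} \<longleftrightarrow>
      (\<exists>x\<in>component (kernel_diff X i) j. image_diff X (i - 1) +>\<^bsub>obj X i\<^esub> x \<noteq> image_diff X (i - 1))"
    by (auto simp: cohomology_sel)
  also have "\<dots> \<longleftrightarrow> (\<exists>x\<in>component (kernel_diff X i) j. x \<notin> image_diff X (i - 1))"
    using abelian_group.coset_eq_self_iff[OF obj_group image_diff_subgroup]
    by (auto simp: kernel_diff_sel)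
  finally show ?thesis by (auto simp: kernel_diff_sel M.component_closed)
qed

end

text \<open>The complex \<open>idempotent_complex A e X\<close> consists of graded vector spaces and
  not of \<open>A\<close>-modules, so \<open>module_complex\<close> does not apply to it. Its
  cocycles and coboundaries are therefore studied inside \<open>X\<close>, where multiplication by
  \<open>e\<close> is a projection that preserves degrees and commutes with the
  differential.\<close>

locale idempotent_module_complex = module_complex K A X
  for K :: "'k ring" and A :: "('k, 'a, nat) graded_module" and X :: "('a, 'm) gr_complex" +
  fixes e :: 'a
  assumes e_degree: "e \<in> component A 0" and e_idem: "e \<otimes>\<^bsub>A\<^esub> e = e"
begin

lemma e_closed: "e \<in> carrier A"
  using e_degree grading.summand_closed by simp

lemma e_smult_component:
  "x \<in> component (obj X i) j \<Longrightarrow> e \<odot>\<^bsub>obj X i\<^esub> x \<in> component (obj X i) j"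
  using graded_left_module.smult_component[OF obj_graded e_degree, of x i j] by simp

lemma e_smult_closed: "x \<in> carrier (obj X i) \<Longrightarrow> e \<odot>\<^bsub>obj X i\<^esub> x \<in> carrier (obj X i)"
  using left_module.smult_closed[OF obj_left_module e_closed] .

lemma e_smult_idem:
  "x \<in> carrier (obj X i) \<Longrightarrow> e \<odot>\<^bsub>obj X i\<^esub> (e \<odot>\<^bsub>obj X i\<^esub> x) = e \<odot>\<^bsub>obj X i\<^esub> x"
  using left_module.smult_assoc[OF obj_left_module e_closed e_closed, of x i] e_idem by simp

lemma e_smult_hom: "abelian_group_hom (obj X i) (obj X i) (\<lambda>x. e \<odot>\<^bsub>obj X i\<^esub> x)"
  using left_module.smult_hom[OF obj_left_module e_closed] .

lemma e_image_subgroup: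
  "additive_subgroup (image_diff (idempotent_complex A e X) (i - 1)) (obj X i)"
proof -
  interpret d: abelian_group_hom "obj X (i - 1)" "obj X i" "diff X (i - 1)" by (rule diff_hom')
  interpret s: abelian_group_hom "obj X (i - 1)" "obj X (i - 1)" "\<lambda>x. e \<odot>\<^bsub>obj X (i - 1)\<^esub> x"
    by (rule e_smult_hom)
  have "abelian_group_hom (obj X (i - 1)) (obj X i) (\<lambda>x. diff X (i - 1) (e \<odot>\<^bsub>obj X (i - 1)\<^esub> x))"
    by (rule additive_homI) (simp_all add: obj_group)
  from group_hom.img_is_subgroup[OF abelian_group_hom.a_group_hom[OF this]]
  show ?thesis
    by (simp add: additive_subgroup_def image_diff_def idempotent_complex_sel idempotent_part_sel
        image_image)
qed

text \<open>Membership in the \<open>e\<close> part is recorded as the equation that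
  \<open>e\<close> fixes \<open>x\<close>; by idempotence the two are equivalent, and the equation
  is what later computations use.\<close>

lemma e_cohomology_nonzeroD:
  assumes "component (cohomology (idempotent_complex A e X) i) j
      \<noteq> {\<zero>\<^bsub>cohomology (idempotent_complex A e X) i\<^esub>}"
  obtains x where "x \<in> component (obj X i) j" "e \<odot>\<^bsub>obj X i\<^esub> x = x"
    "diff X i x = \<zero>\<^bsub>obj X (i + 1)\<^esub>" "x \<notin> image_diff (idempotent_complex A e X) (i - 1)"
proof -
  let ?E = "idempotent_complex A e X"
  interpret M: graded_algebra_module K A "obj X i" by (rule obj_module)
  have *: "component (kernel_diff ?E i) j =
      {x \<in> smult (obj X i) e ` component (obj X i) j. diff X i x = \<zero>\<^bsub>obj X (i + 1)\<^esub>}"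
    unfolding kernel_diff_sel idempotent_complex_sel idempotent_part_sel
    using M.component_closed by blast
  have "\<zero>\<^bsub>obj X i\<^esub> \<in> component (kernel_diff ?E i) j"
    unfolding * using imageI[of "\<zero>\<^bsub>obj X i\<^esub>" "component (obj X i) j" "smult (obj X i) e"]
      M.summand_zero[of j] abelian_group_hom.hom_zero[OF diff_hom]
      abelian_group_hom.hom_zero[OF e_smult_hom] by simp
  then obtain x where x: "x \<in> component (kernel_diff ?E i) j"
      "image_diff ?E (i - 1) +>\<^bsub>obj X i\<^esub> x \<noteq> image_diff ?E (i - 1)"
    using assms by (auto simp: cohomology_sel idempotent_complex_sel)
  then obtain y where y: "y \<in> component (obj X i) j" "x = e \<odot>\<^bsub>obj X i\<^esub> y"
    and dx: "diff X i x = \<zero>\<^bsub>obj X (i + 1)\<^esub>"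
    unfolding * by auto
  show thesis
  proof
    show "x \<in> component (obj X i) j" using y e_smult_component by simp
    then show "x \<notin> image_diff ?E (i - 1)"
      using x abelian_group.coset_eq_self_iff[OF obj_group e_image_subgroup] M.component_closed by blast
    show "e \<odot>\<^bsub>obj X i\<^esub> x = x" using y e_smult_idem M.component_closed by simp
  qed (rule dx)
qed

lemma e_cohomology_nonzeroI:
  assumes x: "x \<in> carrier (obj X i)" "e \<odot>\<^bsub>obj X i\<^esub> x = x" "diff X i x = \<zero>\<^bsub>obj X (i + 1)\<^esub>"
    and "x \<notin> image_diff (idempotent_complex A e X) (i - 1)"
  shows "\<not> zero_module (cohomology (idempotent_complex A e X) i)"
proof -
  let ?E = "idempotent_complex A e X"
  have "x \<in> smult (obj X i) e ` carrier (obj X i)"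
    using x(1,2) by (metis imageI)
  then have "x \<in> carrier (kernel_diff ?E i)"
    using x(3) by (simp add: kernel_diff_sel idempotent_complex_sel idempotent_part_sel)
  then have "image_diff ?E (i - 1) +>\<^bsub>obj X i\<^esub> x \<in> carrier (cohomology ?E i)"
    by (simp add: cohomology_sel idempotent_complex_sel)
  moreover have "image_diff ?E (i - 1) +>\<^bsub>obj X i\<^esub> x \<noteq> \<zero>\<^bsub>cohomology ?E i\<^esub>"
    using assms abelian_group.coset_eq_self_iff[OF obj_group e_image_subgroup]
    by (simp add: cohomology_sel)
  ultimately show ?thesis by (auto simp: zero_module_def)
qed

end

section \<open>Minimal complexes\<close>

text \<open>
  Descending induction on the cohomological degree \<open>i\<close>: if \<open>P\<^sup>i\<close> starts in a degree \<open>t < q - i\<close>,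
  then minimality forces \<open>d\<close> to vanish on the component of degree \<open>t\<close>, because \<open>JP\<^sup>i\<^sup>+\<^sup>1\<close> starts in
  degree at least \<open>q - i\<close>, and that component contains no coboundary, because \<open>JP\<^sup>i\<close> starts
  in degree at least \<open>t + 1\<close>.
\<close>

lemma (in module_complex) minimal_lower_bound:
  assumes rad: "graded_radical A \<subseteq> positive_part" and min: "minimal_complex A X"
    and coh: "\<And>i j. component (cohomology X i) j \<noteq> {\<zero>\<^bsub>cohomology X i\<^esub>} \<Longrightarrow> q \<le> i + j"
    and "i + j < q"
  shows "component (obj X i) j = {\<zero>\<^bsub>obj X i\<^esub>}"
proof -
  obtain b where b: "\<forall>i>b. carrier (obj X i) = {\<zero>\<^bsub>obj X i\<^esub>}" using bounded by blast
  \<comment> \<open>The gain of 1 comes from the radical, which lies in positive degrees: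
    coboundaries start strictly above any degree bound for the whole object.\<close>
  have image: "image_diff X (i - 1) \<subseteq> graded_left_module.truncation (obj X i) (m + 1)"
    if "\<forall>j<m. component (obj X i) j = {\<zero>\<^bsub>obj X i\<^esub>}" for i m
  proof -
    interpret M: graded_algebra_module K A "obj X i" by (rule obj_module)
    have "image_diff X (i - 1) \<subseteq> set_smult A (graded_radical A) (obj X i)"
      using min unfolding minimal_complex_def by (metis diff_add_cancel)
    then show ?thesis
      using M.set_smult_truncation[OF rad M.carrier_truncationI] that by blast
  qed
  \<comment> \<open>Here \<open>n\<close> measures how far \<open>i\<close> may lie below the bound
    \<open>b\<close> above which all objects vanish, turning the descent in \<open>i\<close> into
    ordinary induction; for \<open>n = 0\<close> the object is zero.\<close>
  have "\<forall>j<q - i. component (obj X i) j = {\<zero>\<^bsub>obj X i\<^esub>}" if "b - int n < i" for n i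
    using that
  proof (induction n arbitrary: i)
    case 0
    interpret M: graded_algebra_module K A "obj X i" by (rule obj_module)
    show ?case using 0 b M.component_closed M.summand_zero by fastforce
  next
    case (Suc n)
    interpret M: graded_algebra_module K A "obj X i" by (rule obj_module)
    interpret N: graded_algebra_module K A "obj X (i + 1)" by (rule obj_module)
    have "\<forall>j<q - (i + 1). component (obj X (i + 1)) j = {\<zero>\<^bsub>obj X (i + 1)\<^esub>}"
      using Suc.IH[of "i + 1"] Suc.prems by simp
    from image[OF this] have im: "image_diff X i \<subseteq> N.truncation (q - i)" by simp
    have vanish: "component (obj X i) t = {\<zero>\<^bsub>obj X i\<^esub>}"
      if t: "t < q - i" and low: "\<forall>j<t. component (obj X i) j = {\<zero>\<^bsub>obj X i\<^esub>}" for t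
    proof (rule ccontr)
      assume "component (obj X i) t \<noteq> {\<zero>\<^bsub>obj X i\<^esub>}"
      then obtain x where x: "x \<in> component (obj X i) t" "x \<noteq> \<zero>\<^bsub>obj X i\<^esub>"
        using M.summand_zero[of t] by blast
      have "diff X i x \<in> N.truncation (q - i)"
        using im x M.component_closed by (auto simp: image_diff_def)
      then have "diff X i x = \<zero>\<^bsub>obj X (i + 1)\<^esub>"
        using N.truncation_empty[OF diff_component] x t by blast
      moreover have "x \<notin> image_diff X (i - 1)"
        using image[OF low] M.truncation_empty[OF x(1)] x(2) by force
      ultimately have "component (cohomology X i) t \<noteq> {\<zero>\<^bsub>cohomology X i\<^esub>}"
        unfolding cohomology_nonzero_iff using x(1) by blast
      then show False using coh[of i t] t by simp
    qed
    obtain m where m: "\<forall>j<m. component (obj X i) j = {\<zero>\<^bsub>obj X i\<^esub>}"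
      using M.fin_gen_bounded_below[OF obj_fin_gen] by blast
    \<comment> \<open>Finite generation supplies the starting degree \<open>m\<close> of this
      ascending induction; each step uses \<open>vanish\<close> to remove the component that has
      just become the lowest.\<close>
    have "t \<le> q - i \<longrightarrow> (\<forall>j<t. component (obj X i) j = {\<zero>\<^bsub>obj X i\<^esub>})" if "m \<le> t" for t
      using that
    proof (induction t rule: int_ge_induct)
      case base
      then show ?case using m by blast
    next
      case (step t)
      show ?case
      proof (intro impI allI)
        fix j assume *: "t + 1 \<le> q - i" "j < t + 1"
        show "component (obj X i) j = {\<zero>\<^bsub>obj X i\<^esub>}"
          using step.IH vanish[of t] * by (cases "j = t") auto
      qed
    qed
    from this[of "q - i"] m show ?case by (cases "m \<le> q - i") simp_all
  qed
  \<comment> \<open>The least \<open>n\<close> with \<open>b - int n < i\<close>.\<close>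
  from this[of "nat (b - i + 1)" i] show ?thesis using assms(4) by auto
qed

section \<open>Quasi-isomorphisms\<close>

locale complex_quasi_iso = P: module_complex K A P + X: module_complex K A X
  for K :: "'k ring" and A :: "('k, 'a, nat) graded_module"
    and P :: "('a, 'p) gr_complex" and X :: "('a, 'x) gr_complex" +
  fixes \<phi> :: "int \<Rightarrow> 'p \<Rightarrow> 'x"
  assumes qi: "quasi_iso A P X \<phi>"
begin

lemma map_gr_hom: "gr_hom A (obj P i) (obj X i) (\<phi> i)"
  using qi by (simp add: quasi_iso_def chain_map_def)

lemma map_hom: "abelian_group_hom (obj P i) (obj X i) (\<phi> i)"
  using left_module_hom_additive[OF P.obj_left_module X.obj_left_module] map_gr_hom
  by (simp add: gr_hom_def)

lemma map_component: "x \<in> component (obj P i) j \<Longrightarrow> \<phi> i x \<in> component (obj X i) j"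
  using map_gr_hom[of i] by (auto simp: gr_hom_def)

lemma map_smult:
  "\<lbrakk>a \<in> carrier A; x \<in> carrier (obj P i)\<rbrakk> \<Longrightarrow>
    \<phi> i (a \<odot>\<^bsub>obj P i\<^esub> x) = a \<odot>\<^bsub>obj X i\<^esub> \<phi> i x"
  using map_gr_hom[of i] by (simp add: gr_hom_def left_module_hom_def)

lemma map_diff: "x \<in> carrier (obj P i) \<Longrightarrow> \<phi> (i + 1) (diff P i x) = diff X i (\<phi> i x)"
  using qi by (simp add: quasi_iso_def chain_map_def)

lemma map_diff':
  "x \<in> carrier (obj P (i - 1)) \<Longrightarrow> \<phi> i (diff P (i - 1) x) = diff X (i - 1) (\<phi> (i - 1) x)"
  using map_diff[of x "i - 1"] by simp

lemma map_closed: "x \<in> carrier (obj P i) \<Longrightarrow> \<phi> i x \<in> carrier (obj X i)"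
  using abelian_group_hom.hom_closed[OF map_hom] .

lemma map_kernel: "z \<in> carrier (kernel_diff P i) \<Longrightarrow> \<phi> i z \<in> carrier (kernel_diff X i)"
  using map_diff[of z i] map_closed abelian_group_hom.hom_zero[OF map_hom]
  by (simp add: kernel_diff_sel)

lemma map_image: "z \<in> image_diff P (i - 1) \<Longrightarrow> \<phi> i z \<in> image_diff X (i - 1)"
  using map_diff' map_closed by (auto simp: image_diff_def)

text \<open>Chain maps send coboundaries to coboundaries, so the image of the coboundaries of
  \<open>P\<close> is absorbed by those of \<open>X\<close>. The set-level map in
  \<open>quasi_iso\<close> thus acts on representatives.\<close>

lemma map_coset:
  assumes z: "z \<in> carrier (obj P i)"
  shows "image_diff X (i - 1) <+>\<^bsub>obj X i\<^esub> (\<phi> i ` (image_diff P (i - 1) +>\<^bsub>obj P i\<^esub> z))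
    = image_diff X (i - 1) +>\<^bsub>obj X i\<^esub> \<phi> i z"
    (is "?B <+>\<^bsub>_\<^esub> (_ ` (?C +>\<^bsub>_\<^esub> z)) = _")
proof -
  interpret B: additive_subgroup ?B "obj X i" by (rule X.image_diff_subgroup)
  interpret C: additive_subgroup ?C "obj P i" by (rule P.image_diff_subgroup)
  interpret \<phi>: abelian_group_hom "obj P i" "obj X i" "\<phi> i" by (rule map_hom)
  have "b \<oplus>\<^bsub>obj X i\<^esub> \<phi> i (c \<oplus>\<^bsub>obj P i\<^esub> z) = (b \<oplus>\<^bsub>obj X i\<^esub> \<phi> i c) \<oplus>\<^bsub>obj X i\<^esub> \<phi> i z"
    if "b \<in> ?B" "c \<in> ?C" for b c
    using that z B.a_subset C.a_subset by (simp add: subset_iff \<phi>.H.a_assoc)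
  moreover have "b \<oplus>\<^bsub>obj X i\<^esub> \<phi> i c \<in> ?B" if "b \<in> ?B" "c \<in> ?C" for b c
    using that map_image by blast
  ultimately have "b \<oplus>\<^bsub>obj X i\<^esub> \<phi> i (c \<oplus>\<^bsub>obj P i\<^esub> z) \<in> ?B +>\<^bsub>obj X i\<^esub> \<phi> i z"
    if "b \<in> ?B" "c \<in> ?C" for b c
    using that unfolding a_r_coset_def' by blast
  moreover have "b \<oplus>\<^bsub>obj X i\<^esub> \<phi> i z
      \<in> ?B <+>\<^bsub>obj X i\<^esub> (\<phi> i ` (?C +>\<^bsub>obj P i\<^esub> z))" if "b \<in> ?B" for b
  proof -
    have "\<zero>\<^bsub>obj P i\<^esub> \<oplus>\<^bsub>obj P i\<^esub> z \<in> ?C +>\<^bsub>obj P i\<^esub> z"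
      using C.zero_closed unfolding a_r_coset_def' by blast
    then have "z \<in> ?C +>\<^bsub>obj P i\<^esub> z" using z by simp
    then show ?thesis using that unfolding set_add_def' by blast
  qed
  ultimately show ?thesis by (auto simp: a_r_coset_def' set_add_def')
qed

lemma cohomology_map:
  "bij_betw (\<lambda>C. image_diff X (i - 1) <+>\<^bsub>obj X i\<^esub> (\<phi> i ` C))
    (carrier (cohomology P i)) (carrier (cohomology X i))"
  using qi by (simp add: quasi_iso_def)

text \<open>Injectivity in cohomology, applied to the cosets of \<open>z\<close> and of zero, whose
  images coincide.\<close>

lemma map_reflects_image:
  assumes z: "z \<in> carrier (kernel_diff P i)" and im: "\<phi> i z \<in> image_diff X (i - 1)"
  shows "z \<in> image_diff P (i - 1)"
proof -
  interpret GP: abelian_group "obj P i" by (rule P.obj_group)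
  interpret GX: abelian_group "obj X i" by (rule X.obj_group)
  have zP: "z \<in> carrier (obj P i)" using z by (simp add: kernel_diff_sel)
  have z0: "\<zero>\<^bsub>obj P i\<^esub> \<in> carrier (kernel_diff P i)"
    using abelian_group_hom.hom_zero[OF P.diff_hom] by (simp add: kernel_diff_sel)
  let ?C = "\<lambda>x. image_diff P (i - 1) +>\<^bsub>obj P i\<^esub> x"
  have "image_diff X (i - 1) +>\<^bsub>obj X i\<^esub> \<phi> i \<zero>\<^bsub>obj P i\<^esub> = image_diff X (i - 1)"
    using GX.coset_eq_self_iff[OF X.image_diff_subgroup GX.zero_closed]
      abelian_group_hom.hom_zero[OF map_hom] additive_subgroup.zero_closed[OF X.image_diff_subgroup]
    by simp
  moreover have "image_diff X (i - 1) +>\<^bsub>obj X i\<^esub> \<phi> i z = image_diff X (i - 1)"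
    using GX.coset_eq_self_iff[OF X.image_diff_subgroup map_closed[OF zP]] im by simp
  ultimately have "image_diff X (i - 1) <+>\<^bsub>obj X i\<^esub> (\<phi> i ` ?C z)
      = image_diff X (i - 1) <+>\<^bsub>obj X i\<^esub> (\<phi> i ` ?C \<zero>\<^bsub>obj P i\<^esub>)"
    using map_coset[OF zP] map_coset[OF GP.zero_closed] by simp
  moreover have "?C z \<in> carrier (cohomology P i)" "?C \<zero>\<^bsub>obj P i\<^esub> \<in> carrier (cohomology P i)"
    using z z0 by (simp_all only: cohomology_sel imageI)
  ultimately have "?C z = ?C \<zero>\<^bsub>obj P i\<^esub>"
    by (rule inj_onD[OF bij_betw_imp_inj_on[OF cohomology_map]])
  also have "\<dots> = image_diff P (i - 1)"
    using GP.coset_eq_self_iff[OF P.image_diff_subgroup GP.zero_closed]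
      additive_subgroup.zero_closed[OF P.image_diff_subgroup] by simp
  finally show ?thesis
    using GP.coset_eq_self_iff[OF P.image_diff_subgroup zP] by simp
qed

text \<open>Surjectivity in cohomology. Equality of cosets leaves the correction \<open>b\<close>,
  and nothing makes \<open>z\<close> homogeneous even if \<open>x\<close> is.\<close>

lemma map_surj:
  assumes x: "x \<in> carrier (kernel_diff X i)"
  obtains z b where "z \<in> carrier (kernel_diff P i)" "b \<in> image_diff X (i - 1)"
    "\<phi> i z = b \<oplus>\<^bsub>obj X i\<^esub> x"
proof -
  interpret GX: abelian_group "obj X i" by (rule X.obj_group)
  let ?B = "image_diff X (i - 1)"
  have "?B +>\<^bsub>obj X i\<^esub> x \<in> carrier (cohomology X i)"
    using x by (simp add: cohomology_sel)
  then have "?B +>\<^bsub>obj X i\<^esub> x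
      \<in> (\<lambda>C. ?B <+>\<^bsub>obj X i\<^esub> (\<phi> i ` C)) ` carrier (cohomology P i)"
    using bij_betw_imp_surj_on[OF cohomology_map] by blast
  then obtain z where z: "z \<in> carrier (kernel_diff P i)"
    and eq: "?B +>\<^bsub>obj X i\<^esub> x = ?B <+>\<^bsub>obj X i\<^esub> (\<phi> i ` (image_diff P (i - 1) +>\<^bsub>obj P i\<^esub> z))"
    by (auto simp: cohomology_sel)
  have zP: "z \<in> carrier (obj P i)" using z by (simp add: kernel_diff_sel)
  have "\<zero>\<^bsub>obj X i\<^esub> \<oplus>\<^bsub>obj X i\<^esub> \<phi> i z \<in> ?B +>\<^bsub>obj X i\<^esub> \<phi> i z"
    using additive_subgroup.zero_closed[OF X.image_diff_subgroup]
    unfolding a_r_coset_def' by blast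
  then have "\<phi> i z \<in> ?B +>\<^bsub>obj X i\<^esub> x"
    using eq map_coset[OF zP] map_closed[OF zP] by simp
  then show thesis using that[OF z] unfolding a_r_coset_def' by blast
qed

end

section \<open>Infima of degrees\<close>

text \<open>By discreteness an integer infimum is attained: if \<open>q\<close> were a lower bound
  outside \<open>S\<close>, then \<open>q + 1\<close> would be a lower bound too.\<close>

lemma Inf_of_int_eq_iff:
  fixes S :: "int set"
  shows "Inf ((\<lambda>s. ereal (of_int s)) ` S) = ereal (of_int q) \<longleftrightarrow> q \<in> S \<and> (\<forall>s\<in>S. q \<le> s)"
    (is "Inf ?E = _ \<longleftrightarrow> _")
proof
  assume eq: "Inf ?E = ereal (of_int q)"
  have lower: "q \<le> s" if "s \<in> S" for s
  proof -
    have "Inf ?E \<le> ereal (of_int s)" using that by (intro Inf_lower) blast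
    then show ?thesis using eq by simp
  qed
  have "q \<in> S"
  proof (rule ccontr)
    assume "q \<notin> S"
    then have "q + 1 \<le> s" if "s \<in> S" for s using lower[OF that] that by (cases "s = q") auto
    then have "ereal (of_int (q + 1)) \<le> Inf ?E"
      by (intro Inf_greatest) (auto simp del: of_int_add)
    then show False using eq by simp
  qed
  with lower show "q \<in> S \<and> (\<forall>s\<in>S. q \<le> s)" by blast
next
  assume "q \<in> S \<and> (\<forall>s\<in>S. q \<le> s)"
  then show "Inf ?E = ereal (of_int q)"
    by (intro antisym Inf_lower Inf_greatest) auto
qed

lemma inf_deg_eq_iff:
  "inf_deg M = ereal (of_int q) \<longleftrightarrow>
    component M q \<noteq> {\<zero>\<^bsub>M\<^esub>} \<and> (\<forall>j<q. component M j = {\<zero>\<^bsub>M\<^esub>})"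
proof -
  have "inf_deg M = Inf ((\<lambda>s. ereal (of_int s)) ` {j. component M j \<noteq> {\<zero>\<^bsub>M\<^esub>}})"
    unfolding inf_deg_def by (rule arg_cong[of _ _ Inf]) blast
  then show ?thesis using Inf_of_int_eq_iff by (auto simp: not_le[symmetric])
qed

lemma complex_inf_deg_eq_iff:
  "complex_inf_deg X = ereal (of_int q) \<longleftrightarrow>
    (\<exists>i. component (cohomology X i) (q - i) \<noteq> {\<zero>\<^bsub>cohomology X i\<^esub>}) \<and>
    (\<forall>i j. component (cohomology X i) j \<noteq> {\<zero>\<^bsub>cohomology X i\<^esub>} \<longrightarrow> q \<le> i + j)"
proof -
  let ?S = "{i + j | i j. component (cohomology X i) j \<noteq> {\<zero>\<^bsub>cohomology X i\<^esub>}}"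
  have "complex_inf_deg X = Inf ((\<lambda>s. ereal (of_int s)) ` ?S)"
    unfolding complex_inf_deg_def by (rule arg_cong[of _ _ Inf]) blast
  moreover have "q \<in> ?S \<longleftrightarrow>
      (\<exists>i. component (cohomology X i) (q - i) \<noteq> {\<zero>\<^bsub>cohomology X i\<^esub>})"
  proof
    assume "q \<in> ?S"
    then obtain i j where "q = i + j" "component (cohomology X i) j \<noteq> {\<zero>\<^bsub>cohomology X i\<^esub>}"
      by blast
    then show "\<exists>i. component (cohomology X i) (q - i) \<noteq> {\<zero>\<^bsub>cohomology X i\<^esub>}"
      by (intro exI[of _ i]) simp
  next
    assume "\<exists>i. component (cohomology X i) (q - i) \<noteq> {\<zero>\<^bsub>cohomology X i\<^esub>}"
    then obtain i where "component (cohomology X i) (q - i) \<noteq> {\<zero>\<^bsub>cohomology X i\<^esub>}" by blast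
    moreover have "q = i + (q - i)" by simp
    ultimately show "q \<in> ?S" by blast
  qed
  ultimately show ?thesis using Inf_of_int_eq_iff[of ?S q] by (simp only:) blast
qed

theorem lemma4p8:
  fixes K :: "'k ring"
    and A :: "('k, 'a, nat) graded_module"
    and n k :: nat
    and e :: "nat \<Rightarrow> 'a"
    and X :: "('a, 'x) gr_complex"
    and P :: "('a, 'p) gr_complex"
    and p :: int
  assumes "graded_algebra K A"
    and "locally_finite K A"
    and "noetherian A"
    and "semisimple_ring (degree_zero_ring A)"
    and "simple_representatives (degree_zero_ring A) n e"
    and "right_bounded_complex A X"
    and "\<not> derived_zero X"
    and "graded_projective_resolution A X P"
    and "minimal_complex A P"
    and "k \<in> {1..n}"
    and "ereal (of_int p) = - complex_inf_deg X"
    and "ereal (of_int p) = - complex_inf_deg (idempotent_complex A (e k) X)"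
  shows "\<exists>\<beta> :: int.
    \<not> zero_module (cohomology (idempotent_complex A (e k) P) (- \<beta>)) \<and>
    inf_deg (kernel_diff P (- \<beta>)) = ereal (of_int (\<beta> - p)) \<and>
    component (idempotent_part A (e k) (kernel_diff P (- \<beta>))) (\<beta> - p)
      \<noteq> {\<zero>\<^bsub>idempotent_part A (e k) (kernel_diff P (- \<beta>))\<^esub>}"
proof -
  let ?e = "e k"
  interpret A: graded_algebra K A by (rule assms(1))
  have P: "right_bounded_complex A P" and "\<exists>\<phi>. quasi_iso A P X \<phi>"
    using assms(8) by (simp_all add: graded_projective_resolution_def)
  then obtain \<phi> where "quasi_iso A P X \<phi>" by blast
  then interpret complex_quasi_iso K A P X \<phi>
    using assms(6) P by unfold_locales
  have "primitive_idempotent (degree_zero_ring A) ?e"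
    using assms(5,10) by (simp add: simple_representatives_def)
  then have e: "?e \<in> component A 0" "?e \<otimes>\<^bsub>A\<^esub> ?e = ?e"
    by (simp_all add: primitive_idempotent_def)
  interpret eX: idempotent_module_complex K A X ?e by unfold_locales (rule e)+
  interpret eP: idempotent_module_complex K A P ?e by unfold_locales (rule e)+
  have "complex_inf_deg X = ereal (of_int (- p))"
    "complex_inf_deg (idempotent_complex A ?e X) = ereal (of_int (- p))"
    using assms(11,12) ereal_uminus_uminus by (metis of_int_minus uminus_ereal.simps(1))+
  note degrees = this[unfolded complex_inf_deg_eq_iff]
  note lower = degrees(1)[THEN conjunct2, rule_format]
  obtain i where attained: "component (cohomology (idempotent_complex A ?e X) i) (- p - i)
      \<noteq> {\<zero>\<^bsub>cohomology (idempotent_complex A ?e X) i\<^esub>}"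
    using degrees(2)[THEN conjunct1] by (rule exE)
  have P_zero: "component (obj P i) j = {\<zero>\<^bsub>obj P i\<^esub>}" if "i + j < - p" for i j
  proof (rule P.minimal_lower_bound[OF A.graded_radical_positive[OF assms(4)] assms(9) _ that])
    fix i j assume "component (cohomology P i) j \<noteq> {\<zero>\<^bsub>cohomology P i\<^esub>}"
    then obtain z where z: "z \<in> component (obj P i) j" "diff P i z = \<zero>\<^bsub>obj P (i + 1)\<^esub>"
      "z \<notin> image_diff P (i - 1)"
      unfolding P.cohomology_nonzero_iff by blast
    \<comment> \<open>A cocycle that is not a coboundary keeps this property under
      \<open>\<phi>\<close>, and its degree does not change, so the bound known for \<open>X\<close>
      applies.\<close>
    have "z \<in> carrier (kernel_diff P i)"
      using z graded_left_module.component_closed[OF P.obj_graded] by (simp add: kernel_diff_sel)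
    then have "\<phi> i z \<notin> image_diff X (i - 1)" "diff X i (\<phi> i z) = \<zero>\<^bsub>obj X (i + 1)\<^esub>"
      using map_reflects_image z map_kernel by (auto simp: kernel_diff_sel)
    then have "component (cohomology X i) j \<noteq> {\<zero>\<^bsub>cohomology X i\<^esub>}"
      unfolding X.cohomology_nonzero_iff using map_component[OF z(1)] by blast
    then show "- p \<le> i + j" by (rule lower)
  qed
  interpret Xi: graded_algebra_module K A "obj X i" by (rule X.obj_module)
  interpret Xi': graded_algebra_module K A "obj X (i - 1)" by (rule X.obj_module)
  interpret Pi: graded_algebra_module K A "obj P i" by (rule P.obj_module)
  define j where "j = - p - i"
  let ?BX = "image_diff (idempotent_complex A ?e X) (i - 1)"
  let ?BP = "image_diff (idempotent_complex A ?e P) (i - 1)"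
  obtain x where x: "x \<in> component (obj X i) j" "?e \<odot>\<^bsub>obj X i\<^esub> x = x"
    "diff X i x = \<zero>\<^bsub>obj X (i + 1)\<^esub>" "x \<notin> ?BX"
    using attained[folded j_def] by (rule eX.e_cohomology_nonzeroD)
  have xX: "x \<in> carrier (obj X i)" using Xi.component_closed x(1) .
  then have "x \<in> carrier (kernel_diff X i)" using x by (simp add: kernel_diff_sel)
  then obtain z y where z: "z \<in> carrier (kernel_diff P i)" and y: "y \<in> carrier (obj X (i - 1))"
    and \<phi>z: "\<phi> i z = diff X (i - 1) y \<oplus>\<^bsub>obj X i\<^esub> x"
    by (rule map_surj) (auto simp: image_diff_def)
  have zP: "z \<in> carrier (obj P i)" and dz: "diff P i z = \<zero>\<^bsub>obj P (i + 1)\<^esub>"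
    using z by (simp_all add: kernel_diff_sel)
  \<comment> \<open>The lift \<open>z\<close> is projected into the \<open>e k\<close> part of
    degree \<open>j\<close>. As both projections commute with the differential, the result is still
    a cocycle.\<close>
  define w where "w = ?e \<odot>\<^bsub>obj P i\<^esub> Pi.part z j"
  have w_comp: "w \<in> component (obj P i) j"
    unfolding w_def using Pi.part_mem[OF zP] by (intro eP.e_smult_component) simp
  then have wP: "w \<in> carrier (obj P i)" by (rule Pi.component_closed)
  have ew: "?e \<odot>\<^bsub>obj P i\<^esub> w = w"
    unfolding w_def using eP.e_smult_idem Pi.part_closed[OF zP] by blast
  have dw: "diff P i w = \<zero>\<^bsub>obj P (i + 1)\<^esub>"
  proof -
    interpret Pi1: graded_algebra_module K A "obj P (i + 1)" by (rule P.obj_module)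
    have "diff P i (Pi.part z j) = \<zero>\<^bsub>obj P (i + 1)\<^esub>"
      using gr_hom_part[OF P.obj_graded P.obj_graded P.diff_gr_hom zP, of j] dz by simp
    then show ?thesis
      unfolding w_def using P.diff_smult[OF eP.e_closed Pi.part_closed[OF zP]]
        Pi1.smult_zero_right[OF eP.e_closed] by simp
  qed
  \<comment> \<open>A preimage of \<open>w\<close> in the \<open>e k\<close> part of
    \<open>P\<close> would make \<open>\<phi> i w\<close> a coboundary of the \<open>e k\<close>
    part of \<open>X\<close>. Since \<open>\<phi> i w\<close> is \<open>x\<close> plus such a
    coboundary, \<open>x\<close> would be one as well.\<close>
  have w_notin: "w \<notin> ?BP"
  proof
    assume "w \<in> ?BP"
    then obtain u where u: "u \<in> carrier (obj P (i - 1))"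
      and w: "w = diff P (i - 1) (?e \<odot>\<^bsub>obj P (i - 1)\<^esub> u)"
      by (auto simp: image_diff_def idempotent_complex_sel idempotent_part_sel)
    have "\<phi> i w = diff X (i - 1) (?e \<odot>\<^bsub>obj X (i - 1)\<^esub> \<phi> (i - 1) u)"
      unfolding w using u map_diff' map_smult[OF eP.e_closed] eP.e_smult_closed by simp
    then have \<phi>w: "\<phi> i w \<in> ?BX"
      using map_closed[OF u] by (auto simp: image_diff_def idempotent_complex_sel idempotent_part_sel)
    \<comment> \<open>The error term of the lift under the same two projections. They can be moved
      inside the differential, so \<open>c\<close> is the coboundary of an element of the
      \<open>e k\<close> part; \<open>x\<close> itself is left unchanged by both.\<close>
    define c where "c = ?e \<odot>\<^bsub>obj X i\<^esub> diff X (i - 1) (Xi'.part y j)"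
    have py: "Xi'.part y j \<in> carrier (obj X (i - 1))" using y by simp
    have "c = diff X (i - 1) (?e \<odot>\<^bsub>obj X (i - 1)\<^esub> Xi'.part y j)"
      unfolding c_def using X.diff_smult[OF eX.e_closed py] by simp
    then have c: "c \<in> ?BX"
      using py by (auto simp: image_diff_def idempotent_complex_sel idempotent_part_sel)
    have dy: "diff X (i - 1) y \<in> carrier (obj X i)"
      using y abelian_group_hom.hom_closed[OF X.diff_hom'] by simp
    have "Xi.part (diff X (i - 1) y) j = diff X (i - 1) (Xi'.part y j)"
      using gr_hom_part[OF X.obj_graded X.obj_graded X.diff_gr_hom[of "i - 1"] y, of j] by simp
    moreover have "Xi.part x j = x" using Xi.part_summand x(1) by simp
    ultimately have "Xi.part (\<phi> i z) j = diff X (i - 1) (Xi'.part y j) \<oplus>\<^bsub>obj X i\<^esub> x"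
      unfolding \<phi>z using Xi.part_add[OF dy xX] by simp
    moreover have "Xi.part (\<phi> i z) j = \<phi> i (Pi.part z j)"
      using gr_hom_part[OF P.obj_graded X.obj_graded map_gr_hom zP] .
    moreover have "\<phi> i w = ?e \<odot>\<^bsub>obj X i\<^esub> \<phi> i (Pi.part z j)"
      unfolding w_def using map_smult[OF eP.e_closed Pi.part_closed[OF zP]] .
    moreover have "diff X (i - 1) (Xi'.part y j) \<in> carrier (obj X i)"
      using py abelian_group_hom.hom_closed[OF X.diff_hom'] by blast
    ultimately have "\<phi> i w = c \<oplus>\<^bsub>obj X i\<^esub> x"
      using Xi.smult_r_distr[OF eX.e_closed _ xX] x(2) by (simp add: c_def)
    moreover have "c \<in> carrier (obj X i)"
      using c additive_subgroup.a_subset[OF eX.e_image_subgroup] by blast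
    ultimately have "x = \<ominus>\<^bsub>obj X i\<^esub> c \<oplus>\<^bsub>obj X i\<^esub> \<phi> i w"
      using xX abelian_group.r_neg1[OF X.obj_group] by simp
    also have "\<dots> \<in> ?BX"
      using c \<phi>w additive_subgroup.a_closed[OF eX.e_image_subgroup]
        additive_subgroup.a_inv_closed[OF eX.e_image_subgroup] by blast
    finally show False using x(4) by contradiction
  qed
  have w0: "w \<noteq> \<zero>\<^bsub>obj P i\<^esub>"
    using w_notin additive_subgroup.zero_closed[OF eP.e_image_subgroup] by metis
  have w_ker: "w \<in> component (kernel_diff P i) j"
    using w_comp wP dw by (simp add: kernel_diff_sel)
  have "\<not> zero_module (cohomology (idempotent_complex A ?e P) i)"
    using eP.e_cohomology_nonzeroI wP ew dw w_notin by blast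
  \<comment> \<open>The kernel inherits the lower bound from the whole object
    \<open>obj P i\<close>, and \<open>w\<close> attains it.\<close>
  moreover have "inf_deg (kernel_diff P i) = ereal (of_int j)"
    unfolding inf_deg_eq_iff
  proof (intro conjI allI impI)
    show "component (kernel_diff P i) j \<noteq> {\<zero>\<^bsub>kernel_diff P i\<^esub>}"
      using w_ker w0 by (auto simp: kernel_diff_sel)
  next
    fix l assume "l < j"
    then have "component (obj P i) l = {\<zero>\<^bsub>obj P i\<^esub>}" by (intro P_zero) (simp add: j_def)
    then show "component (kernel_diff P i) l = {\<zero>\<^bsub>kernel_diff P i\<^esub>}"
      using abelian_group_hom.hom_zero[OF P.diff_hom] by (auto simp: kernel_diff_sel)
  qed
  moreover have "component (idempotent_part A ?e (kernel_diff P i)) j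
      \<noteq> {\<zero>\<^bsub>idempotent_part A ?e (kernel_diff P i)\<^esub>}"
  proof -
    have "w \<in> smult (obj P i) ?e ` component (kernel_diff P i) j"
      using w_ker ew by (metis imageI)
    then show ?thesis using w0 by (auto simp: idempotent_part_sel kernel_diff_sel(3,4))
  qed
  moreover have "- i - p = j" by (simp add: j_def)
  ultimately show ?thesis by (intro exI[of _ "- i"]) simp
qed

end
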